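(* Let $k > 2$ be even, let $F_k$ be the free group on $a_1,\dots,a_k$, let $w = [a_1,a_2]\cdots[a_{k-1},a_k]$, and let $\gamma \in F_k$. Suppose that the word $w[w,\gamma w\gamma^{-1}]$ is cyclically reduced and has word length (with respect to $a_1,\dots,a_k$) different from that of $w$. Let $N$ be the normal closure of $w[w,\gamma w \gamma^{-1}]$ in $F_k$ and $G = F_k/N = \langle a_1,\dots,a_k : w[w,\gamma w\gamma^{-1}]\rangle$. Then $G/\gamma_i(G) \cong \Gamma_{k/2}/\gamma_i(\Gamma_{k/2})$ for all $i\ge1$, where $\Gamma_{k/2} = F_k/\langle\langle w\rangle\rangle_{F_k}$ is the genus $k/2$ surface group, and there is an automorphism $\phi$ of $F_k$ with $\phi(N)$ a proper subgroup of $\langle\langle w\rangle\rangle_{F_k}$ (i.e. $G$ is weakly $k/2$-parasurface of Type II).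
   Context: $\gamma_i$ denotes the lower central series: $\gamma_1(G)=G$, $\gamma_i(G)=[G,\gamma_{i-1}(G)]$. $[x,y]$ denotes the commutator (fixed standard convention). $\langle\langle w\rangle\rangle_{F_k}$ is the normal closure of $w$ in $F_k$. *)

theory Defs
  imports "HOL-Algebra.Algebra"
begin

text \<open>A letter (i, True) stands for a_i, (i, False) for a_i^{-1}.\<close>

type_synonym letter = "nat \<times> bool"

definition inv_letter :: "letter \<Rightarrow> letter" where
  "inv_letter l = (fst l, \<not> snd l)"

fun reduced :: "letter list \<Rightarrow> bool" where
  "reduced [] = True"
| "reduced [x] = True"
| "reduced (x # y # zs) = (y \<noteq> inv_letter x \<and> reduced (y # zs))"

definition cyclically_reduced :: "letter list \<Rightarrow> bool" where
  "cyclically_reduced xs = (reduced xs \<and>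
     (length xs \<ge> 2 \<longrightarrow> last xs \<noteq> inv_letter (hd xs)))"

fun cons_cancel :: "letter \<Rightarrow> letter list \<Rightarrow> letter list" where
  "cons_cancel l [] = [l]"
| "cons_cancel l (m # ms) = (if m = inv_letter l then ms else l # m # ms)"

definition word_mult :: "letter list \<Rightarrow> letter list \<Rightarrow> letter list" where
  "word_mult xs ys = foldr cons_cancel xs ys"

definition free_group :: "nat \<Rightarrow> letter list monoid" where
  "free_group k = \<lparr> carrier = {xs. reduced xs \<and> fst ` set xs \<subseteq> {1..k}},
                    monoid.mult = word_mult, one = [] \<rparr>"

definition gen :: "nat \<Rightarrow> letter list" where
  "gen i = [(i, True)]"

definition commutator :: "('a, 'b) monoid_scheme \<Rightarrow> 'a \<Rightarrow> 'a \<Rightarrow> 'a" where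
  "commutator G x y = x \<otimes>\<^bsub>G\<^esub> y \<otimes>\<^bsub>G\<^esub> inv\<^bsub>G\<^esub> x \<otimes>\<^bsub>G\<^esub> inv\<^bsub>G\<^esub> y"

text \<open>lcs G n is gamma_{n+1}(G): gamma_1 = G, gamma_{i+1} = [G, gamma_i].\<close>
fun lcs :: "('a, 'b) monoid_scheme \<Rightarrow> nat \<Rightarrow> 'a set" where
  "lcs G 0 = carrier G"
| "lcs G (Suc n) = generate G {commutator G x y | x y. x \<in> carrier G \<and> y \<in> lcs G n}"

definition lower_central :: "('a, 'b) monoid_scheme \<Rightarrow> nat \<Rightarrow> 'a set" where
  "lower_central G i = lcs G (i - 1)"  \<comment> \<open>gamma_i(G), meaningful for i \<ge> 1\<close>

definition normal_closure :: "('a, 'b) monoid_scheme \<Rightarrow> 'a set \<Rightarrow> 'a set" where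
  "normal_closure G S = generate G {g \<otimes>\<^bsub>G\<^esub> s \<otimes>\<^bsub>G\<^esub> inv\<^bsub>G\<^esub> g | g s. g \<in> carrier G \<and> s \<in> S}"

definition surface_word :: "nat \<Rightarrow> letter list" where
  "surface_word k = foldr (\<lambda>j acc. commutator (free_group k) (gen (2*j - 1)) (gen (2*j))
                               \<otimes>\<^bsub>free_group k\<^esub> acc) [1..<k div 2 + 1] []"

end

theory Submission
  imports Defs "HOL-Library.Countable_Set" "HOL-Library.Nat_Bijection"
begin

text \<open>
  In \<open>F/N\<close> the relator says that \<open>w\<close> is a commutator of two of its conjugates, up to inversion, so \<open>w\<close>
  lies in every term of the lower central series; hence \<open>F/N\<close> and \<open>F/\<langle>\<langle>w\<rangle>\<rangle>\<close> have the same lower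
  central quotients. Clearly \<open>N \<subseteq> \<langle>\<langle>w\<rangle>\<rangle>\<close>, and \<open>\<phi>\<close> is the identity; the point is that \<open>w \<notin> N\<close>.

  If \<open>w \<in> N\<close>, then \<open>r\<close> and \<open>w\<close> have the same normal closure, and \<open>r\<close> is conjugate to \<open>w\<^sup>\<plusminus>\<^sup>1\<close> (Magnus),
  so these cyclically reduced words have equal length. To see this, put \<open>t = a\<^sub>1\<close>, \<open>b = a\<^sub>2\<close> and
  \<open>y\<^sub>h = t\<^sup>h y t\<^sup>-\<^sup>h\<close>. The word \<open>w\<close> becomes \<open>b\<^sub>1 b\<^sub>0\<inverse> v\<^sub>0\<close>, a member of a basis, and \<open>r\<close> becomes a word
  \<open>r\<^sub>0\<close> in letters of heights \<open>m, \<dots>, M\<close>. By the HNN embedding \<open>r\<^sub>0\<close> entails all translates of \<open>w\<close> that fit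
  in this range; abelianising, \<open>M = m + 1\<close>. After a change of basis \<open>r\<^sub>0\<close> entails a single
  letter \<open>x\<close>, and by the Freiheitssatz it is a conjugate of a power of \<open>x\<close>, namely of \<open>x\<^sup>\<plusminus>\<^sup>1\<close>.

  Membership in a normal closure is replaced throughout by the semantic notion \<open>entails r u\<close>: every
  permutation action of the letters on \<open>\<nat>\<close> in which \<open>r\<close> acts trivially makes \<open>u\<close> act trivially.
\<close>

section \<open>Words acting by permutations\<close>

abbreviation perm_inv :: "('x \<Rightarrow> 'x) \<Rightarrow> 'x \<Rightarrow> 'x" where
  "perm_inv \<equiv> inv_into UNIV"

definition inv_word :: "letter list \<Rightarrow> letter list" where
  "inv_word u = rev (map inv_letter u)"

definition letter_act :: "(nat \<Rightarrow> 'x \<Rightarrow> 'x) \<Rightarrow> letter \<Rightarrow> 'x \<Rightarrow> 'x" where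
  "letter_act f l = (if snd l then f (fst l) else perm_inv (f (fst l)))"

fun act :: "(nat \<Rightarrow> 'x \<Rightarrow> 'x) \<Rightarrow> letter list \<Rightarrow> 'x \<Rightarrow> 'x" where
  "act f [] = id"
| "act f (l # u) = letter_act f l \<circ> act f u"

definition perms :: "(nat \<Rightarrow> 'x \<Rightarrow> 'x) \<Rightarrow> bool" where
  "perms f \<longleftrightarrow> (\<forall>i. bij (f i))"

definition letters :: "letter list \<Rightarrow> nat set" where
  "letters u = fst ` set u"

lemma letters_simps [simp]:
  "letters [] = {}" "letters (l # u) = insert (fst l) (letters u)"
  "letters (u @ v) = letters u \<union> letters v"
  by (auto simp: letters_def)

lemma finite_letters [simp]: "finite (letters u)"
  by (simp add: letters_def)

lemma inv_letter_simps [simp]: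
  "inv_letter (i, s) = (i, \<not> s)" "inv_letter (inv_letter l) = l"
  "fst (inv_letter l) = fst l" "inv_letter l \<noteq> l" "l \<noteq> inv_letter l"
  "inv_letter l = inv_letter m \<longleftrightarrow> l = m"
  by (auto simp: inv_letter_def prod_eq_iff)

lemma inv_word_simps [simp]:
  "inv_word [] = []" "inv_word (l # u) = inv_word u @ [inv_letter l]"
  "inv_word (u @ v) = inv_word v @ inv_word u" "length (inv_word u) = length u"
  by (auto simp: inv_word_def)

lemma inv_word_inv_word [simp]: "inv_word (inv_word u) = u"
  by (induction u) auto

lemma letters_inv_word [simp]: "letters (inv_word u) = letters u"
  by (induction u) auto

lemma act_append [simp]: "act f (u @ v) = act f u \<circ> act f v"
  by (induction u) auto

lemma permsD: "perms f \<Longrightarrow> bij (f i)"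
  by (simp add: perms_def)

lemma bij_letter_act: "perms f \<Longrightarrow> bij (letter_act f l)"
  by (simp add: letter_act_def perms_def bij_imp_bij_inv)

lemma letter_act_inv: "perms f \<Longrightarrow> letter_act f (inv_letter l) = perm_inv (letter_act f l)"
  by (simp add: letter_act_def perms_def inv_letter_def inv_inv_eq)

lemma bij_act: "perms f \<Longrightarrow> bij (act f u)"
  by (induction u) (auto intro: bij_comp bij_letter_act)

lemma act_inv_word: "perms f \<Longrightarrow> act f (inv_word u) = perm_inv (act f u)"
  by (induction u) (auto simp: letter_act_inv o_inv_distrib bij_act bij_letter_act)

lemma act_inv_comp [simp]:
  assumes "perms f"
  shows "act f (inv_word u) \<circ> act f u = id" "act f u \<circ> act f (inv_word u) = id"
    "act f (inv_word u) (act f u x) = x" "act f u (act f (inv_word u) x) = x"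
  using bij_act[OF assms, of u]
  by (auto simp: act_inv_word[OF assms] bij_is_inj bij_is_surj surj_iff surj_f_inv_f)

lemma letter_act_canc [simp]:
  "perms f \<Longrightarrow> letter_act f l (letter_act f (inv_letter l) x) = x"
  using act_inv_comp(4)[of f "[l]"] by simp

lemma act_cong: "(\<And>i. i \<in> letters u \<Longrightarrow> f i = g i) \<Longrightarrow> act f u = act g u"
  by (induction u) (auto simp: letter_act_def)

text \<open>Quantifying over actions on \<nat> keeps the definition free of type variables;
  \<open>entailsD\<close> recovers actions on arbitrary types.\<close>

definition entails :: "letter list \<Rightarrow> letter list \<Rightarrow> bool" where
  "entails r u \<longleftrightarrow> (\<forall>f :: nat \<Rightarrow> nat \<Rightarrow> nat. perms f \<longrightarrow> act f r = id \<longrightarrow> act f u = id)"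

text \<open>Equality in the free group, phrased semantically; \<open>word_eq_iff_norm\<close>
  identifies it with equality of reduced forms.\<close>

definition word_eq :: "letter list \<Rightarrow> letter list \<Rightarrow> bool" (infix "\<approx>\<^sub>F" 50) where
  "u \<approx>\<^sub>F v \<longleftrightarrow> (\<forall>f :: nat \<Rightarrow> nat \<Rightarrow> nat. perms f \<longrightarrow> act f u = act f v)"

text \<open>Carries an action on a countably infinite set over to \<nat>, where
  \<open>entails\<close> and \<open>word_eq\<close> are tested.\<close>

lemma transport:
  assumes "bij_betw \<beta> S (UNIV :: nat set)" and "\<And>i :: nat. bij_betw (h i) S S"
  obtains f :: "nat \<Rightarrow> nat \<Rightarrow> nat"
  where "perms f" "\<And>i s. s \<in> S \<Longrightarrow> f i (\<beta> s) = \<beta> (h i s)"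
    "\<And>i s. s \<in> S \<Longrightarrow> perm_inv (f i) (\<beta> (h i s)) = \<beta> s"
proof -
  define f where "f i = \<beta> \<circ> h i \<circ> inv_into S \<beta>" for i
  have b: "bij (f i)" for i
    unfolding f_def using bij_betw_trans[OF bij_betw_trans[OF bij_betw_inv_into[OF assms(1)] assms(2)[of i]] assms(1)]
    by (simp add: comp_assoc)
  have e: "f i (\<beta> s) = \<beta> (h i s)" if "s \<in> S" for i s
    using that assms(1) by (simp add: f_def bij_betw_inv_into_left)
  show thesis
  proof
    show "perms f" using b by (simp add: perms_def)
    show "f i (\<beta> s) = \<beta> (h i s)" if "s \<in> S" for i s using e that .
    show "perm_inv (f i) (\<beta> (h i s)) = \<beta> s" if "s \<in> S" for i s
      using e[OF that, of i] b[of i] by (metis bij_inv_eq_iff)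
  qed
qed

text \<open>Only the countable orbit of a moved point matters; crossing it with \<open>\<nat>\<close> makes it infinite.\<close>

lemma entailsD:
  fixes f :: "nat \<Rightarrow> 'x \<Rightarrow> 'x"
  assumes "entails r u" and f: "perms f" and r: "act f r = id"
  shows "act f u = id"
proof (rule ext)
  fix x
  define Ob where "Ob = range (\<lambda>v. act f v x)"
  define S where "S = Ob \<times> (UNIV :: nat set)"
  have "countable S" "infinite S"
    by (auto simp: S_def Ob_def finite_cartesian_product_iff)
  then have \<beta>: "bij_betw (to_nat_on S) S UNIV" by (rule to_nat_on_infinite)
  have mem: "act f v y \<in> Ob" if "y \<in> Ob" for v y
  proof -
    obtain v' where "y = act f v' x" using \<open>y \<in> Ob\<close> by (auto simp: Ob_def)
    then have "act f v y = act f (v @ v') x" by simp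
    then show ?thesis unfolding Ob_def by blast
  qed
  have xO: "x \<in> Ob" unfolding Ob_def by (rule range_eqI[of _ _ "[]"]) simp
  have la: "letter_act f l y \<in> Ob" if "y \<in> Ob" for l y
    using mem[OF that, of "[l]"] by simp
  have canc: "perm_inv (f i) (f i y) = y" "f i (perm_inv (f i) y) = y" for i y
    using permsD[OF f, of i] by (simp_all add: bij_is_inj bij_is_surj surj_f_inv_f)
  have fO: "f i y \<in> Ob" "perm_inv (f i) y \<in> Ob" if "y \<in> Ob" for i y
    using la[OF that, of "(i, True)"] la[OF that, of "(i, False)"] by (simp_all add: letter_act_def)
  define h where "h i p = (f i (fst p), snd p)" for i and p :: "'x \<times> nat"
  have hb: "bij_betw (h i) S S" for i
  proof (rule bij_betw_byWitness[where f' = "\<lambda>p. (perm_inv (f i) (fst p), snd p)"])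
    show "h i ` S \<subseteq> S" by (auto simp: h_def S_def fO)
    show "(\<lambda>p. (perm_inv (f i) (fst p), snd p)) ` S \<subseteq> S"
      by (auto simp: S_def fO)
  qed (auto simp: h_def canc)
  obtain g where g: "perms g"
    and g1: "\<And>i s. s \<in> S \<Longrightarrow> g i (to_nat_on S s) = to_nat_on S (h i s)"
    and g2: "\<And>i s. s \<in> S \<Longrightarrow> perm_inv (g i) (to_nat_on S (h i s)) = to_nat_on S s"
    by (rule transport[where h = h, OF \<beta> hb]) blast
  have gl: "letter_act g l (to_nat_on S (y, m)) = to_nat_on S (letter_act f l y, m)"
    if "y \<in> Ob" for l y m
  proof (cases "snd l")
    case True
    then show ?thesis using that g1[of "(y, m)" "fst l"] by (simp add: letter_act_def S_def h_def)
  next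
    case False
    then show ?thesis
      using that la[OF that, of l] g2[of "(perm_inv (f (fst l)) y, m)" "fst l"]
      by (simp add: letter_act_def S_def h_def canc)
  qed
  have ga: "act g v (to_nat_on S (y, m)) = to_nat_on S (act f v y, m)" if "y \<in> Ob" for v y m
    using that by (induction v) (auto simp: gl mem)
  have "act g r = id"
  proof (rule ext)
    fix n
    obtain p where "p \<in> S" "n = to_nat_on S p"
      using bij_betw_imp_surj_on[OF \<beta>] by (metis UNIV_I imageE)
    then show "act g r n = id n" using ga[of "fst p" r "snd p"] r by (auto simp: S_def)
  qed
  then have "act g u = id" using assms(1) g by (simp add: entails_def)
  then have "to_nat_on S (x, 0) = to_nat_on S (act f u x, 0)" using ga[OF xO, of u 0] by simp
  then show "act f u x = id x"
    using inj_onD[OF bij_betw_imp_inj_on[OF \<beta>], of "(x, 0)" "(act f u x, 0)"] mem[OF xO, of u] xO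
    by (simp add: S_def)
qed

lemma act_inv_eq_id_iff:
  assumes "perms f"
  shows "act f (inv_word u @ v) = id \<longleftrightarrow> act f u = act f v"
  by (metis act_append act_inv_comp(1,2) assms comp_assoc comp_id id_comp)

text \<open>Equality of \<open>u\<close> and \<open>v\<close> says that the empty relator entails
  \<open>inv_word u @ v\<close>, so \<open>entailsD\<close> extends it to actions on any
  type.\<close>

lemma word_eqD:
  assumes "u \<approx>\<^sub>F v" "perms f"
  shows "act f u = act f v"
proof -
  have "entails [] (inv_word u @ v)"
    using assms(1) by (auto simp: entails_def word_eq_def act_inv_eq_id_iff simp del: act_append)
  from entailsD[OF this assms(2)] show ?thesis using act_inv_eq_id_iff[OF assms(2)] by simp
qed

lemma word_eq_refl [simp, intro]: "u \<approx>\<^sub>F u"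
  by (simp add: word_eq_def)

lemma word_eq_sym: "u \<approx>\<^sub>F v \<Longrightarrow> v \<approx>\<^sub>F u"
  by (simp add: word_eq_def)

lemma word_eq_trans [trans]: "u \<approx>\<^sub>F v \<Longrightarrow> v \<approx>\<^sub>F x \<Longrightarrow> u \<approx>\<^sub>F x"
  by (simp add: word_eq_def)

lemma word_eq_append: "u \<approx>\<^sub>F v \<Longrightarrow> u' \<approx>\<^sub>F v' \<Longrightarrow> u @ u' \<approx>\<^sub>F v @ v'"
  by (simp add: word_eq_def)

lemma entails_word_eq: "u \<approx>\<^sub>F v \<Longrightarrow> entails r u \<Longrightarrow> entails r v"
  by (auto simp: entails_def word_eq_def)

lemma entails_conj: "entails r u \<Longrightarrow> entails r (p @ u @ inv_word p)"
  by (auto simp: entails_def)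

lemma conj_act_eq_id_iff:
  assumes "perms f"
  shows "act f (p @ u @ inv_word p) = id \<longleftrightarrow> act f u = id"
proof
  assume "act f (p @ u @ inv_word p) = id"
  then have "act f (inv_word p) \<circ> act f (p @ u @ inv_word p) \<circ> act f p = id"
    using assms by (simp only: comp_id act_inv_comp)
  moreover have "act f (inv_word p) \<circ> act f (p @ u @ inv_word p) \<circ> act f p = act f u"
    using assms by (auto simp: fun_eq_iff)
  ultimately show "act f u = id" by simp
qed (use assms in simp)

lemma entails_of_conj: "r \<approx>\<^sub>F p @ s @ inv_word p \<Longrightarrow> entails r u \<Longrightarrow> entails s u"
  unfolding entails_def word_eq_def using conj_act_eq_id_iff by metis

subsection \<open>Substitution\<close>

definition subst_letter :: "(nat \<Rightarrow> letter list) \<Rightarrow> letter \<Rightarrow> letter list" where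
  "subst_letter \<sigma> l = (if snd l then \<sigma> (fst l) else inv_word (\<sigma> (fst l)))"

definition subst :: "(nat \<Rightarrow> letter list) \<Rightarrow> letter list \<Rightarrow> letter list" where
  "subst \<sigma> u = concat (map (subst_letter \<sigma>) u)"

lemma subst_simps [simp]:
  "subst \<sigma> [] = []" "subst \<sigma> (l # u) = subst_letter \<sigma> l @ subst \<sigma> u"
  "subst \<sigma> (u @ v) = subst \<sigma> u @ subst \<sigma> v"
  by (auto simp: subst_def)

lemma subst_letter_inv: "subst_letter \<sigma> (inv_letter l) = inv_word (subst_letter \<sigma> l)"
  by (auto simp: subst_letter_def inv_letter_def)

lemma subst_inv_word: "subst \<sigma> (inv_word u) = inv_word (subst \<sigma> u)"
  by (induction u) (auto simp: subst_letter_inv)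

lemma act_subst:
  assumes "perms f"
  shows "act f (subst \<sigma> u) = act (\<lambda>i. act f (\<sigma> i)) u"
  by (induction u) (auto simp: subst_letter_def letter_act_def act_inv_word[OF assms])

lemma perms_act: "perms f \<Longrightarrow> perms (\<lambda>i. act f (\<sigma> i))"
  by (simp add: perms_def[of "\<lambda>i. act f (\<sigma> i)"] bij_act)

lemma entails_subst: "entails r u \<Longrightarrow> entails (subst \<sigma> r) (subst \<sigma> u)"
  using perms_act by (fastforce simp: entails_def act_subst)

lemma word_eq_subst: "u \<approx>\<^sub>F v \<Longrightarrow> subst \<sigma> u \<approx>\<^sub>F subst \<sigma> v"
  using perms_act by (fastforce simp: word_eq_def act_subst)

subsection \<open>Reduced words\<close>

lemma cons_cancel_reduced: "reduced u \<Longrightarrow> reduced (cons_cancel l u)"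
  by (cases "(l, u)" rule: cons_cancel.cases; cases u rule: reduced.cases) auto

lemma cons_cancel_inv: "reduced u \<Longrightarrow> cons_cancel (inv_letter l) (cons_cancel l u) = u"
  by (cases u rule: reduced.cases) auto

lemma cons_cancel_inv': "reduced u \<Longrightarrow> cons_cancel l (cons_cancel (inv_letter l) u) = u"
  using cons_cancel_inv[of u "inv_letter l"] by simp

lemma foldr_cons_cancel_reduced: "reduced v \<Longrightarrow> reduced (foldr cons_cancel u v)"
  by (induction u) (auto intro: cons_cancel_reduced)

lemma reduced_Cons: "reduced (l # u) \<Longrightarrow> reduced u"
  by (cases u) auto

lemma cons_cancel_reduced_Cons: "reduced (l # u) \<Longrightarrow> cons_cancel l u = l # u"
  by (cases u) auto

lemma cons_cancel_word_eq: "cons_cancel l u \<approx>\<^sub>F l # u"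
proof (cases u)
  case (Cons m ms)
  have "ms \<approx>\<^sub>F l # inv_letter l # ms"
    by (simp add: word_eq_def fun_eq_iff)
  then show ?thesis using Cons by auto
qed auto

definition norm_word :: "letter list \<Rightarrow> letter list" where
  "norm_word u = foldr cons_cancel u []"

lemma norm_word_simps [simp]: "norm_word [] = []" "norm_word (l # u) = cons_cancel l (norm_word u)"
  by (simp_all add: norm_word_def)

lemma reduced_norm_word [simp]: "reduced (norm_word u)"
  by (simp add: norm_word_def foldr_cons_cancel_reduced)

lemma norm_word_reduced: "reduced u \<Longrightarrow> norm_word u = u"
proof (induction u)
  case (Cons l u)
  then show ?case using reduced_Cons[OF Cons.prems] by (simp add: cons_cancel_reduced_Cons)
qed simp

lemma norm_word_eq: "norm_word u \<approx>\<^sub>F u"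
proof (induction u)
  case (Cons l u)
  have "cons_cancel l (norm_word u) \<approx>\<^sub>F l # norm_word u" by (rule cons_cancel_word_eq)
  also have "l # norm_word u \<approx>\<^sub>F l # u" using word_eq_append[OF word_eq_refl Cons, of "[l]"] by simp
  finally show ?case by simp
qed simp

lemma length_cons_cancel: "length (cons_cancel l u) \<le> Suc (length u)"
  by (cases u) auto

lemma length_norm_word: "length (norm_word u) \<le> length u"
  by (induction u) (auto intro: order_trans[OF length_cons_cancel])

lemma letters_cons_cancel: "letters (cons_cancel l u) \<subseteq> insert (fst l) (letters u)"
  by (cases u) auto

lemma letters_norm_word: "letters (norm_word u) \<subseteq> letters u"
  by (induction u) (use letters_cons_cancel in fastforce)+

text \<open>Van der Waerden's action of the free group on reduced words by left multiplication.
  Unreduced lists are fixed, so that each letter permutes the whole type.\<close>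

definition free_act :: "nat \<Rightarrow> letter list \<Rightarrow> letter list" where
  "free_act i u = (if reduced u then cons_cancel (i, True) u else u)"

lemma free_act_perms: "perms free_act"
  unfolding perms_def
proof
  fix i
  show "bij (free_act i)"
    by (rule bij_betw_byWitness[where f' = "\<lambda>u. if reduced u then cons_cancel (i, False) u else u"])
      (use cons_cancel_inv[of _ "(i, True)"] cons_cancel_inv'[of _ "(i, True)"] in
        \<open>auto simp: free_act_def cons_cancel_reduced\<close>)
qed

lemma letter_act_free: "reduced u \<Longrightarrow> letter_act free_act l u = cons_cancel l u"
proof (cases l)
  case (Pair i s)
  assume u: "reduced u"
  have "free_act i (cons_cancel (i, False) u) = u"
    using u cons_cancel_inv'[of u "(i, True)"] by (auto simp: free_act_def cons_cancel_reduced)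
  then have "perm_inv (free_act i) u = cons_cancel (i, False) u"
    using permsD[OF free_act_perms, of i] by (metis bij_inv_eq_iff)
  then show ?thesis using u Pair by (cases s) (auto simp: letter_act_def free_act_def)
qed

lemma act_free: "act free_act u [] = norm_word u"
  by (induction u) (auto simp: letter_act_free)

text \<open>Under \<open>free_act\<close> a word carries the empty list to its normal form, so equal
  group elements have equal normal forms.\<close>

lemma word_eq_norm: "u \<approx>\<^sub>F v \<Longrightarrow> norm_word u = norm_word v"
  using word_eqD[OF _ free_act_perms] act_free by metis

lemma word_eq_iff_norm: "u \<approx>\<^sub>F v \<longleftrightarrow> norm_word u = norm_word v"
  by (metis word_eq_norm norm_word_eq word_eq_sym word_eq_trans)

lemma reduced_word_eq: "u \<approx>\<^sub>F v \<Longrightarrow> reduced u \<Longrightarrow> reduced v \<Longrightarrow> u = v"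
  by (metis word_eq_norm norm_word_reduced)

lemma reduced_appendD: "reduced (u @ v) \<Longrightarrow> reduced u \<and> reduced v"
  by (induction u rule: reduced.induct) (auto dest: reduced_Cons)

lemma reduced_append_iff:
  "reduced (u @ v) \<longleftrightarrow> reduced u \<and> reduced v \<and> (u \<noteq> [] \<longrightarrow> v \<noteq> [] \<longrightarrow> hd v \<noteq> inv_letter (last u))"
proof (induction u rule: reduced.induct)
  case (2 x)
  then show ?case by (cases v) auto
qed auto

lemma reduced_inv_word: "reduced u \<Longrightarrow> reduced (inv_word u)"
proof (induction u)
  case (Cons l u)
  then have "reduced (inv_word u)" by (auto dest: reduced_Cons)
  moreover have "last (inv_word u) = inv_letter (hd u)" if "u \<noteq> []"
    using that by (cases u) auto
  moreover have "hd u \<noteq> inv_letter l" if "u \<noteq> []" using that Cons.prems by (cases u) auto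
  ultimately show ?case
    by (simp add: reduced_append_iff) (metis inv_word_inv_word inv_word_simps(1) inv_letter_simps(2))
qed simp

section \<open>Cyclically reduced words: powers, rotation and conjugation\<close>

lemma cyclically_reduced_iff:
  "cyclically_reduced u \<longleftrightarrow> reduced u \<and> (u = [] \<or> last u \<noteq> inv_letter (hd u))"
  unfolding cyclically_reduced_def
  by (cases u rule: reduced.cases) auto

lemma cyclically_reduced_power:
  assumes "cyclically_reduced u"
  shows "reduced (concat (replicate n u))"
proof (cases "u = []")
  case False
  have "reduced (concat (replicate n u)) \<and> (n > 0 \<longrightarrow> hd (concat (replicate n u)) = hd u)"
  proof (induction n)
    case (Suc n)
    have "hd u \<noteq> inv_letter (last u)"
      using assms False by (metis cyclically_reduced_iff inv_letter_simps(2))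
    then show ?case using Suc assms False
      by (cases n) (auto simp: reduced_append_iff cyclically_reduced_iff)
  qed simp
  then show ?thesis by simp
qed simp

lemma cyclically_reduced_inv_word:
  "cyclically_reduced u \<Longrightarrow> cyclically_reduced (inv_word u)"
  by (cases "u = []")
    (auto simp: cyclically_reduced_iff reduced_inv_word[unfolded inv_word_def] inv_word_def hd_rev last_rev hd_map last_map)

lemma cyclically_reduced_rotate:
  assumes "cyclically_reduced (u @ v)"
  shows "cyclically_reduced (v @ u)"
proof (cases "u = [] \<or> v = []")
  case False
  then show ?thesis using assms
    by (auto simp: cyclically_reduced_iff reduced_append_iff)
qed (use assms in auto)

text \<open>Mutually inverse first and last letters are stripped from the reduced form until none
  remain; the stripped letters make up \<open>p\<close>.\<close>

lemma cyclic_reduction: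
  obtains p s where "u \<approx>\<^sub>F p @ s @ inv_word p" "cyclically_reduced s" "letters s \<subseteq> letters u"
proof -
  have "\<exists>p s. u \<approx>\<^sub>F p @ s @ inv_word p \<and> cyclically_reduced s \<and> letters s \<subseteq> letters u" if "reduced u" for u
    using that
  proof (induction u rule: length_induct)
    case (1 u)
    show ?case
    proof (cases "cyclically_reduced u")
      case True
      then show ?thesis by (intro exI[of _ "[]"] exI[of _ u]) auto
    next
      case False
      then have ne: "u \<noteq> []" and l: "last u = inv_letter (hd u)" using 1 by (auto simp: cyclically_reduced_iff)
      then obtain v where v: "u = hd u # v @ [inv_letter (hd u)]"
        by (metis append_butlast_last_id append_Cons append_Nil inv_letter_simps(4) list.collapse list.sel(1) last.simps last_tl)
      then have "reduced v" using 1 by (metis reduced_Cons reduced_appendD)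
      moreover have "length v < length u" using v by (metis length_Cons length_append less_Suc_eq not_add_less1 not_less_eq)
      ultimately obtain p s where ps: "v \<approx>\<^sub>F p @ s @ inv_word p" "cyclically_reduced s" "letters s \<subseteq> letters v"
        using 1 by blast
      have "[hd u] @ v @ [inv_letter (hd u)] \<approx>\<^sub>F [hd u] @ (p @ s @ inv_word p) @ [inv_letter (hd u)]"
        by (intro word_eq_append ps word_eq_refl)
      then have "u \<approx>\<^sub>F (hd u # p) @ s @ inv_word (hd u # p)" using v by (metis append.assoc append_Cons append_Nil inv_word_simps(2))
      moreover have "letters v \<subseteq> letters u" using v by (metis letters_simps(2,3) Un_upper1 subset_insertI2)
      ultimately show ?thesis using ps by blast
    qed
  qed
  from this[OF reduced_norm_word, of u] obtain p s
    where "norm_word u \<approx>\<^sub>F p @ s @ inv_word p" "cyclically_reduced s" "letters s \<subseteq> letters (norm_word u)"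
    by blast
  then show thesis using that letters_norm_word norm_word_eq
    by (meson order_trans word_eq_sym word_eq_trans)
qed

text \<open>The \<open>n\<close>-th power of \<open>u\<close> is reduced of length
  \<open>n * length u\<close>, while its form as a conjugate bounds this by
  \<open>n * length v + 2 * length p\<close>.\<close>

lemma conj_cyclically_reduced_length_le:
  assumes "u \<approx>\<^sub>F p @ v @ inv_word p" "cyclically_reduced u"
  shows "length u \<le> length v"
proof -
  have "concat (replicate n u) \<approx>\<^sub>F p @ concat (replicate n v) @ inv_word p" for n
  proof (induction n)
    case 0
    show ?case by (simp add: word_eq_def)
  next
    case (Suc n)
    from word_eq_append[OF assms(1) this] show ?case
      by (auto simp: word_eq_def fun_eq_iff)
  qed
  from word_eq_norm[OF this] have "length (concat (replicate n u)) \<le> length (p @ concat (replicate n v) @ inv_word p)" for n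
    using length_norm_word norm_word_reduced[OF cyclically_reduced_power[OF assms(2)]] by metis
  \<comment> \<open>With an exponent larger than \<open>2 * length p\<close>, an excess of one
    letter per factor already outweighs the conjugators.\<close>
  from this[of "Suc (2 * length p)"]
  have *: "Suc (2 * length p) * length u \<le> Suc (2 * length p) * length v + 2 * length p"
    by (simp add: length_concat sum_list_replicate mult_2 del: mult_Suc replicate.simps)
  show ?thesis
  proof (rule ccontr)
    assume "\<not> length u \<le> length v"
    then have "Suc (2 * length p) * (Suc (length v)) \<le> Suc (2 * length p) * length u"
      by (intro mult_le_mono2) auto
    then show False using * by simp
  qed
qed

lemma conj_cyclically_reduced_length:
  assumes "u \<approx>\<^sub>F p @ v @ inv_word p" "cyclically_reduced u" "cyclically_reduced v"
  shows "length u = length v"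
proof (rule antisym)
  have "v \<approx>\<^sub>F inv_word p @ u @ inv_word (inv_word p)"
    using assms(1) by (auto simp: word_eq_def fun_eq_iff)
  then show "length v \<le> length u" using assms(3) by (rule conj_cyclically_reduced_length_le)
qed (use assms conj_cyclically_reduced_length_le in blast)

subsection \<open>A free universal action\<close>

text \<open>The group presented by \<open>r\<close>, realised on classes of words and taken \<open>\<nat>\<close> many times;
  \<open>c\<close> is the number of the copy.\<close>

lemma universal_action:
  "\<exists>(f :: nat \<Rightarrow> nat \<Rightarrow> nat) (c :: nat \<Rightarrow> nat). perms f \<and> (\<forall>u. act f u = id \<longleftrightarrow> entails r u) \<and>
    (\<forall>u x. act f u x = x \<longrightarrow> act f u = id) \<and> (\<forall>u x. c (act f u x) = c x) \<and> surj c"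
proof -
  define cls where "cls u = {v. entails r (inv_word u @ v)}" for u
  have cls_eq: "cls u = cls v \<longleftrightarrow> entails r (inv_word u @ v)" for u v
  proof
    assume "cls u = cls v"
    moreover have "v \<in> cls v" by (auto simp: cls_def entails_def)
    ultimately show "entails r (inv_word u @ v)" by (auto simp: cls_def)
  next
    assume "entails r (inv_word u @ v)"
    then show "cls u = cls v"
      unfolding cls_def entails_def using act_inv_eq_id_iff by (metis (mono_tags, opaque_lifting))
  qed
  have cls_word_eq: "u \<approx>\<^sub>F v \<Longrightarrow> cls u = cls v" for u v
    unfolding cls_eq by (simp add: entails_def word_eq_def act_inv_eq_id_iff del: act_append)
  define S where "S = range cls \<times> (UNIV :: nat set)"
  have "countable S" "infinite S" by (auto simp: S_def finite_cartesian_product_iff)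
  then have \<beta>: "bij_betw (to_nat_on S) S UNIV" by (rule to_nat_on_infinite)
  \<comment> \<open>Left multiplication by the letter \<open>i\<close> on the classes
    \<open>cls u\<close> of the presented group, written as a preimage so that no representative has
    to be chosen.\<close>
  define h where "h i p = ({v. (i, False) # v \<in> fst p}, snd p)" for i :: nat and p :: "letter list set \<times> nat"
  have h: "h i (cls u, m) = (cls ((i, True) # u), m)" for i u m
    by (auto simp: h_def cls_def)
  have canc: "cls ((i, s) # (i, \<not> s) # u) = cls u" for i s u
    using cls_word_eq[OF cons_cancel_word_eq, of "(i, s)" "(i, \<not> s) # u"] by simp
  have hb: "bij_betw (h i) S S" for i
  proof (rule bij_betw_byWitness[where f' = "\<lambda>p. ({v. (i, True) # v \<in> fst p}, snd p)"])
    have h': "{v. (i, True) # v \<in> cls u} = cls ((i, False) # u)" for u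
      by (auto simp: cls_def)
    show "\<forall>a\<in>S. ({v. (i, True) # v \<in> fst (h i a)}, snd (h i a)) = a"
      using canc[of i False] by (auto simp: S_def h h')
    show "\<forall>a\<in>S. h i ({v. (i, True) # v \<in> fst a}, snd a) = a"
      using canc[of i True] by (auto simp: S_def h h')
    show "h i ` S \<subseteq> S" by (auto simp: S_def h)
    show "(\<lambda>p. ({v. (i, True) # v \<in> fst p}, snd p)) ` S \<subseteq> S" by (auto simp: S_def h')
  qed
  obtain f where f: "perms f"
    and f1: "\<And>i s. s \<in> S \<Longrightarrow> f i (to_nat_on S s) = to_nat_on S (h i s)"
    and f2: "\<And>i s. s \<in> S \<Longrightarrow> perm_inv (f i) (to_nat_on S (h i s)) = to_nat_on S s"
    by (rule transport[where h = h, OF \<beta> hb]) blast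
  define b where "b u m = to_nat_on S (cls u, m)" for u m
  have b_inj: "b u m = b v n \<longleftrightarrow> cls u = cls v \<and> m = n" for u v m n
    unfolding b_def by (subst inj_on_eq_iff[OF bij_betw_imp_inj_on[OF \<beta>]]) (auto simp: S_def)
  have b_surj: "\<exists>u m. x = b u m" for x
    using bij_betw_imp_surj_on[OF \<beta>] by (auto simp: b_def S_def image_iff set_eq_iff)
  have fl: "letter_act f l (b u m) = b (l # u) m" for l u m
  proof (cases l)
    case (Pair i s)
    show ?thesis
    proof (cases s)
      case True
      then show ?thesis using f1[of "(cls u, m)" i] Pair by (simp add: letter_act_def b_def S_def h)
    next
      case False
      then show ?thesis using f2[of "(cls ((i, False) # u), m)" i] Pair canc[of i True u]
        by (simp add: letter_act_def b_def S_def h)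
    qed
  qed
  have fa: "act f v (b u m) = b (v @ u) m" for v u m
    by (induction v) (auto simp: fl)
  \<comment> \<open>A fixed point makes a conjugate of \<open>v\<close> a consequence of
    \<open>r\<close>, hence \<open>v\<close> itself: the regular action is free.\<close>
  have fixed: "entails r v" if "act f v (b u m) = b u m" for u v m
  proof -
    have "entails r (inv_word u @ v @ u)"
      using that cls_eq fa b_inj by metis
    then have "entails r (u @ (inv_word u @ v @ u) @ inv_word u)" by (rule entails_conj)
    then show ?thesis by (rule entails_word_eq[rotated]) (auto simp: word_eq_def fun_eq_iff)
  qed
  have ent: "act f v = id" if "entails r v" for v
  proof
    fix x
    obtain u m where x: "x = b u m" using b_surj by blast
    have "entails r (inv_word u @ v @ u)" using entails_conj[OF that, of "inv_word u"] by simp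
    then show "act f v x = id x" using cls_eq fa b_inj x by (metis id_apply)
  qed
  define c where "c x = (SOME m. \<exists>u. x = b u m)" for x
  have c: "c (b u m) = m" for u m
    unfolding c_def by (rule some_equality) (auto simp: b_inj)
  show ?thesis
  proof (intro exI[of _ f] exI[of _ c] conjI allI impI)
    show "act f u = id \<longleftrightarrow> entails r u" for u
      using fixed ent by (metis id_apply)
    show "act f u = id" if "act f u x = x" for u x
      using fixed ent b_surj that by metis
    show "c (act f u x) = c x" for u x
      using b_surj[of x] by (auto simp: fa c)
    show "surj c" using c by (metis surjI)
  qed (rule f)
qed

section \<open>Equations with nonzero exponent sum\<close>

fun exp_sum :: "nat \<Rightarrow> letter list \<Rightarrow> int" where
  "exp_sum b [] = 0"
| "exp_sum b (l # u) = (if fst l = b then if snd l then 1 else - 1 else 0) + exp_sum b u"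

lemma exp_sum_append [simp]: "exp_sum b (u @ v) = exp_sum b u + exp_sum b v"
  by (induction u) auto

text \<open>Infinite lower unitriangular matrices: \<open>M i k\<close> is the entry in row \<open>i\<close>, column \<open>k\<close>.
  Over the rationals, an equation with nonzero exponent sum in the unknown is solved one
  subdiagonal at a time.\<close>

type_synonym mat = "nat \<Rightarrow> nat \<Rightarrow> rat"

definition unitri :: "mat \<Rightarrow> bool" where
  "unitri M \<longleftrightarrow> (\<forall>i. M i i = 1) \<and> (\<forall>i k. i < k \<longrightarrow> M i k = 0)"

definition mat_one :: mat where
  "mat_one i k = (if i = k then 1 else 0)"

text \<open>Only indices between column and row contribute for lower triangular factors, so the sums
  are finite.\<close>

definition mat_mul :: "mat \<Rightarrow> mat \<Rightarrow> mat" where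
  "mat_mul M N i k = (\<Sum>j\<in>{k..i}. M i j * N j k)"

definition mat_act :: "mat \<Rightarrow> (nat \<Rightarrow> rat) \<Rightarrow> nat \<Rightarrow> rat" where
  "mat_act M v i = (\<Sum>k\<le>i. M i k * v k)"

lemma mat_act_mul: "mat_act (mat_mul M N) = mat_act M \<circ> mat_act N"
proof (intro ext)
  fix v i
  have "mat_act (mat_mul M N) v i = (\<Sum>k\<le>i. \<Sum>j\<in>{k..i}. M i j * N j k * v k)"
    by (simp add: mat_act_def mat_mul_def sum_distrib_right)
  also have "\<dots> = (\<Sum>j\<le>i. \<Sum>k\<le>j. M i j * N j k * v k)"
    by (subst sum.Sigma, simp, simp, subst sum.Sigma, simp, simp,
        rule sum.reindex_bij_witness[where i = "\<lambda>(j, k). (k, j)" and j = "\<lambda>(k, j). (j, k)"]) auto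
  also have "\<dots> = (mat_act M \<circ> mat_act N) v i"
    by (simp add: mat_act_def sum_distrib_left mult.assoc)
  finally show "mat_act (mat_mul M N) v i = (mat_act M \<circ> mat_act N) v i" .
qed

lemma mat_act_one: "mat_act mat_one = id"
proof (intro ext)
  fix v i
  have "mat_act mat_one v i = (\<Sum>k\<le>i. if k = i then v k else 0)"
    unfolding mat_act_def by (rule sum.cong) (auto simp: mat_one_def)
  then show "mat_act mat_one v i = id v i" by simp
qed

text \<open>Unit vectors recover the entries from the action, so distinct unitriangular matrices act
  differently.\<close>

lemma mat_act_entry:
  assumes "k \<le> i"
  shows "mat_act M (\<lambda>j. if j = k then 1 else 0) i = M i k"
proof -
  have "mat_act M (\<lambda>j. if j = k then 1 else 0) i = (\<Sum>j\<le>i. if j = k then M i j else 0)"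
    unfolding mat_act_def by (rule sum.cong) auto
  then show ?thesis using assms by simp
qed

lemma unitri_one: "unitri mat_one"
  by (simp add: unitri_def mat_one_def)

lemma unitri_mul: "unitri M \<Longrightarrow> unitri N \<Longrightarrow> unitri (mat_mul M N)"
  by (simp add: unitri_def mat_mul_def)

text \<open>Forward substitution for the equation \<open>mat_mul M X = mat_one\<close>.\<close>

fun mat_inv :: "mat \<Rightarrow> mat" where
  "mat_inv M i k = (if i < k then 0 else if i = k then 1 else - (\<Sum>j\<in>{k..<i}. M i j * mat_inv M j k))"

declare mat_inv.simps [simp del]

lemma unitri_inv: "unitri (mat_inv M)"
  unfolding unitri_def by (simp add: mat_inv.simps)

lemma mat_mul_inv:
  assumes "unitri M"
  shows "mat_mul M (mat_inv M) = mat_one"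
proof (intro ext)
  fix i k
  show "mat_mul M (mat_inv M) i k = mat_one i k"
  proof (cases "k < i")
    case True
    then have "{k..i} = insert i {k..<i}" by auto
    then show ?thesis using True assms mat_inv.simps[of M i k]
      by (simp add: mat_mul_def mat_one_def unitri_def)
  next
    case False
    then show ?thesis using assms mat_inv.simps[of M i i]
      by (cases "i = k") (auto simp: mat_mul_def mat_one_def unitri_def)
  qed
qed

text \<open>\<open>mat_mul_inv\<close> supplies right inverses only. Since \<open>mat_inv M\<close>
  has a right inverse too, which must act as \<open>M\<close>, the inverse is two-sided.\<close>

lemma mat_act_inv:
  assumes "unitri M"
  shows "bij (mat_act M)" "perm_inv (mat_act M) = mat_act (mat_inv M)"
proof -
  have 1: "mat_act M \<circ> mat_act (mat_inv M) = id"
    using mat_mul_inv[OF assms] by (metis mat_act_mul mat_act_one)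
  have 2: "mat_act (mat_inv M) \<circ> mat_act (mat_inv (mat_inv M)) = id"
    using mat_mul_inv[OF unitri_inv] by (metis mat_act_mul mat_act_one)
  have "mat_act (mat_inv (mat_inv M)) = mat_act M"
    using 1 2 by (metis comp_assoc comp_id id_comp)
  with 1 2 show "bij (mat_act M)" by (metis o_bij)
  with 1 show "perm_inv (mat_act M) = mat_act (mat_inv M)"
    by (metis bij_is_inj comp_assoc comp_id id_comp inv_o_cancel)
qed

fun word_mat :: "(letter \<Rightarrow> mat) \<Rightarrow> letter list \<Rightarrow> mat" where
  "word_mat Y [] = mat_one"
| "word_mat Y (l # u) = mat_mul (Y l) (word_mat Y u)"

lemma unitri_word_mat: "(\<And>l. unitri (Y l)) \<Longrightarrow> unitri (word_mat Y u)"
  by (induction u) (auto simp: unitri_one unitri_mul)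

definition letter_mat :: "(nat \<Rightarrow> mat) \<Rightarrow> letter \<Rightarrow> mat" where
  "letter_mat M l = (if snd l then M (fst l) else mat_inv (M (fst l)))"

lemma unitri_letter_mat: "(\<And>i. unitri (M i)) \<Longrightarrow> unitri (letter_mat M l)"
  by (simp add: letter_mat_def unitri_inv)

lemma act_mat:
  assumes "\<And>i. unitri (M i)"
  shows "act (\<lambda>i. mat_act (M i)) u = mat_act (word_mat (letter_mat M) u)"
  by (induction u) (auto simp: mat_act_one mat_act_mul letter_act_def letter_mat_def mat_act_inv[OF assms])

lemma perms_mat: "(\<And>i. unitri (M i)) \<Longrightarrow> perms (\<lambda>i. mat_act (M i))"
  by (simp add: perms_def mat_act_inv)

text \<open>\<open>P\<close> and \<open>Q\<close> agree above the \<open>d\<close>-th subdiagonal, where they differ by \<open>a\<delta>\<close>.\<close>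

definition mat_near :: "nat \<Rightarrow> (nat \<Rightarrow> rat) \<Rightarrow> rat \<Rightarrow> mat \<Rightarrow> mat \<Rightarrow> bool" where
  "mat_near d \<delta> a P Q \<longleftrightarrow> (\<forall>i k. i < k + d \<longrightarrow> Q i k = P i k) \<and> (\<forall>k. Q (k + d) k = P (k + d) k + a * \<delta> k)"

lemma sum_ends:
  fixes g :: "nat \<Rightarrow> rat"
  assumes "d > 0"
  shows "sum g {k..k + d} = g k + sum g {k<..<k + d} + g (k + d)"
proof -
  have "{k..k + d} = insert k (insert (k + d) {k<..<k + d})" using assms by auto
  then show ?thesis using assms by simp
qed

text \<open>In position \<open>(k + d, k)\<close> the perturbed entries meet only diagonal entries
  \<open>1\<close>, and the inner terms are unchanged, so the perturbations add.\<close>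

lemma mat_near_mul:
  assumes "d > 0" "mat_near d \<delta> a P P'" "mat_near d \<delta> c Q Q'"
    and u: "unitri P" "unitri Q" "unitri P'" "unitri Q'"
  shows "mat_near d \<delta> (a + c) (mat_mul P Q) (mat_mul P' Q')"
  unfolding mat_near_def
proof safe
  fix i k assume "i < k + d"
  then show "mat_mul P' Q' i k = mat_mul P Q i k"
    unfolding mat_mul_def using assms(2,3) by (intro sum.cong) (auto simp: mat_near_def)
next
  fix k
  have "(\<Sum>j\<in>{k<..<k + d}. P' (k + d) j * Q' j k) = (\<Sum>j\<in>{k<..<k + d}. P (k + d) j * Q j k)"
    using assms(2,3) by (intro sum.cong) (auto simp: mat_near_def)
  then show "mat_mul P' Q' (k + d) k = mat_mul P Q (k + d) k + (a + c) * \<delta> k"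
    unfolding mat_mul_def sum_ends[OF assms(1)]
    using u assms(2,3)[unfolded mat_near_def, THEN conjunct2, rule_format, of k]
    by (simp add: unitri_def distrib_right)
qed

lemma mat_near_inv:
  assumes "d > 0" "mat_near d \<delta> a P P'" and u: "unitri P" "unitri P'"
  shows "mat_near d \<delta> (- a) (mat_inv P) (mat_inv P')"
proof -
  have 1: "mat_inv P' i k = mat_inv P i k" if "i < k + d" for i k
    using that
  proof (induction i rule: less_induct)
    case (less i)
    have "(\<Sum>j\<in>{k..<i}. P' i j * mat_inv P' j k) = (\<Sum>j\<in>{k..<i}. P i j * mat_inv P j k)"
      using assms(2) less by (intro sum.cong) (auto simp: mat_near_def)
    then show ?case by (simp add: mat_inv.simps[of _ i k])
  qed
  have 2: "mat_inv P' (k + d) k = mat_inv P (k + d) k + (- a) * \<delta> k" for k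
  proof -
    have e: "{k..<k + d} = insert k {k<..<k + d}" using assms(1) by auto
    have "(\<Sum>j\<in>{k<..<k + d}. P' (k + d) j * mat_inv P' j k) = (\<Sum>j\<in>{k<..<k + d}. P (k + d) j * mat_inv P j k)"
      using assms(2) 1 by (intro sum.cong) (auto simp: mat_near_def)
    then show ?thesis using assms(1) assms(2)[unfolded mat_near_def, THEN conjunct2, rule_format, of k]
      by (simp add: mat_inv.simps[of _ "k + d" k] mat_inv.simps[of _ k k] e)
  qed
  from 1 2 show ?thesis by (auto simp: mat_near_def)
qed

lemma mat_near_refl: "mat_near d \<delta> 0 P P"
  by (simp add: mat_near_def)

text \<open>Each occurrence of \<open>b\<close> contributes its sign, so to first order the value of
  \<open>u\<close> moves by the exponent sum of \<open>b\<close>.\<close>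

lemma mat_near_word:
  assumes "d > 0" "mat_near d \<delta> 1 B B'" and M: "\<And>i. unitri (M i)" and B: "unitri B" "unitri B'"
  shows "mat_near d \<delta> (of_int (exp_sum b u)) (word_mat (letter_mat (M(b := B))) u)
    (word_mat (letter_mat (M(b := B'))) u)"
proof (induction u)
  case (Cons l u)
  have "mat_near d \<delta> (of_int (if fst l = b then if snd l then 1 else - 1 else 0))
    (letter_mat (M(b := B)) l) (letter_mat (M(b := B')) l)"
    using assms(2) mat_near_inv[OF assms(1,2) B] by (auto simp: letter_mat_def mat_near_refl)
  moreover have "unitri (letter_mat (M(b := C)) l)" "unitri (word_mat (letter_mat (M(b := C))) u)"
    if "unitri C" for C
    using that M by (auto intro!: unitri_letter_mat unitri_word_mat)
  ultimately show ?case using mat_near_mul[OF assms(1) _ Cons.IH] B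
    unfolding exp_sum.simps word_mat.simps of_int_add by blast
qed (simp add: mat_near_refl)

lemma solve_unitri:
  assumes e: "exp_sum b r \<noteq> 0" and M: "\<And>i. unitri (M i)"
  obtains B where "unitri B" "word_mat (letter_mat (M(b := B))) r = mat_one"
proof -
  define R where "R B = word_mat (letter_mat (M(b := B))) r" for B
  \<comment> \<open>By \<open>mat_near_word\<close>, a change of \<open>B\<close> on subdiagonal
    \<open>Suc d\<close> changes \<open>R B\<close> there by the exponent sum times as much;
    dividing by that sum cancels the error.\<close>
  define next_mat where
    "next_mat d B = (\<lambda>i k. if i = k + Suc d then B i k - R B i k / of_int (exp_sum b r) else B i k)" for d B
  define Bs where "Bs = rec_nat mat_one next_mat"
  have Bs: "Bs 0 = mat_one" "Bs (Suc d) = next_mat d (Bs d)" for d by (simp_all add: Bs_def)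
  have uB: "unitri (Bs d)" for d
    by (induction d) (simp_all add: Bs unitri_one, simp add: unitri_def next_mat_def)
  have uR: "unitri (R B)" if "unitri B" for B
    unfolding R_def using that M by (auto intro!: unitri_word_mat unitri_letter_mat)
  have RBs: "R (Bs d) i k = 0" if "k < i" "i \<le> k + d" for d i k
    using that
  proof (induction d arbitrary: i k)
    case (Suc d)
    let ?\<delta> = "\<lambda>k. - R (Bs d) (k + Suc d) k / of_int (exp_sum b r)"
    have "mat_near (Suc d) ?\<delta> 1 (Bs d) (Bs (Suc d))"
      by (auto simp: mat_near_def Bs next_mat_def)
    from mat_near_word[OF _ this M uB uB, of b r]
    have n: "mat_near (Suc d) ?\<delta> (of_int (exp_sum b r)) (R (Bs d)) (R (Bs (Suc d)))"
      by (simp add: R_def)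
    show ?case
    proof (cases "i = k + Suc d")
      case True
      then show ?thesis using n e by (simp add: mat_near_def)
    next
      case False
      then have "i < k + Suc d" using Suc.prems by simp
      then show ?thesis using n Suc by (simp add: mat_near_def)
    qed
  qed simp
  have stable: "Bs (d + c) i k = Bs d i k" if "i \<le> k + d" for c d i k
    using that by (induction c) (auto simp: Bs next_mat_def)
  \<comment> \<open>Entries on subdiagonal \<open>i - k\<close> are final from stage
    \<open>i - k\<close> on, so the limit is read off diagonally.\<close>
  define B where "B i k = Bs (i - k) i k" for i k
  have B: "unitri B" using uB by (auto simp: unitri_def B_def)
  have agree: "B i k = Bs d i k" if "i \<le> k + d" for d i k
    using stable[of i k "i - k" "d - (i - k)"] that by (simp add: B_def)
  have "R B i k = mat_one i k" for i k
  proof (cases "k < i")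
    case True
    let ?\<delta> = "\<lambda>k'. B (k' + Suc i) k' - Bs i (k' + Suc i) k'"
    have "mat_near (Suc i) ?\<delta> 1 (Bs i) B" by (auto simp: mat_near_def agree)
    from mat_near_word[OF _ this M uB B, of b r]
    have "R B i k = R (Bs i) i k" by (simp add: R_def mat_near_def)
    then show ?thesis using RBs[of k i i] True by (simp add: mat_one_def)
  next
    case False
    then show ?thesis using uR[OF B] by (cases "i = k") (auto simp: unitri_def mat_one_def)
  qed
  then have "R B = mat_one" by (intro ext)
  then show thesis using that B by (simp add: R_def)
qed

text \<open>The word \<open>u\<close> is read as a path down the basis vectors; each maximal run of
  equal letters gives a Jordan block or the inverse of one.\<close>

lemma unitri_faithful:
  assumes "reduced u" "u \<noteq> []"
  obtains M where "\<And>i. unitri (M i)" "word_mat (letter_mat M) u \<noteq> mat_one"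
proof -
  \<comment> \<open>\<open>word_mat\<close> applies the last letter first, so \<open>q ! j\<close>
    is the letter applied at time \<open>j\<close>.\<close>
  define q where "q = rev u"
  define run where "run l i k \<longleftrightarrow> i \<le> length q \<and> (\<forall>j. k \<le> j \<and> j < i \<longrightarrow> q ! j = l)" for l i k
  \<comment> \<open>On a run of \<open>l\<close> this is a block \<open>1 + S\<close> with
    \<open>S\<close> the shift to the next basis vector; on a run of \<open>inv_letter l\<close> it
    is the inverse \<open>1 - S + S^2 - ...\<close>.\<close>
  define Y :: "letter \<Rightarrow> mat" where
    "Y l i k = (if i = k then 1 else if i < k then 0 else if run l i k then if i = Suc k then 1 else 0
      else if run (inv_letter l) i k then (- 1) ^ (i - k) else 0)" for l i k
  have uY: "unitri (Y l)" for l by (auto simp: unitri_def Y_def)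
  have adj: "q ! Suc j \<noteq> inv_letter (q ! j)" if "Suc j < length q" for j
  proof
    assume a: "q ! Suc j = inv_letter (q ! j)"
    have "u = rev (drop (Suc (Suc j)) q) @ [q ! Suc j, q ! j] @ rev (take j q)"
      using that unfolding q_def
      by (metis Cons_nth_drop_Suc Suc_lessD append.assoc append_Cons append_Nil append_take_drop_id
          q_def rev.simps(2) rev_append rev_rev_ident)
    then show False using assms(1) a by (auto dest: reduced_appendD)
  qed
  have inv: "mat_mul (Y l) (Y (inv_letter l)) = mat_one" for l
  proof (intro ext)
    fix i k
    show "mat_mul (Y l) (Y (inv_letter l)) i k = mat_one i k"
    proof (cases "k < i")
      case True
      have "(\<Sum>j\<in>{k..i}. Y l i j * Y (inv_letter l) j k) = 0"
      \<comment> \<open>Within one run only two neighbouring terms survive, with opposite signs;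
        otherwise every term vanishes.\<close>
      proof (cases "run l i k \<or> run (inv_letter l) i k")
        case ex: True
        have r: "\<not> (run l j j' \<and> run (inv_letter l) j j')" if "j' < j" for j j'
          using that by (auto simp: run_def)
        show ?thesis
        proof (cases "run l i k")
          case rl: True
          have "Y l i j * Y (inv_letter l) j k =
            (if j = i then (- 1) ^ (i - k) else 0) + (if Suc j = i then (- 1) ^ (i - Suc k) else 0)"
            if "j \<in> {k..i}" for j
          proof -
            have "run l i j" "run l j k" using rl that by (auto simp: run_def)
            then show ?thesis using that r True rl by (auto simp: Y_def)
          qed
          then have "(\<Sum>j\<in>{k..i}. Y l i j * Y (inv_letter l) j k) =
            (\<Sum>j\<in>{k..i}. (if j = i then (- 1) ^ (i - k) else 0) + (if j = i - 1 then (- 1) ^ (i - Suc k) else 0))"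
            using True by (intro sum.cong) auto
          also have "\<dots> = (- 1) ^ (i - k) + (- 1) ^ (i - Suc k)"
            using True by (simp add: sum.distrib)
          also have "\<dots> = (0 :: rat)"
            using True by (cases i) (auto simp: Suc_diff_le less_Suc_eq_le)
          finally show ?thesis .
        next
          case False
          then have rl: "run (inv_letter l) i k" using ex by simp
          have "Y l i j * Y (inv_letter l) j k =
            (if j = k then (- 1) ^ (i - k) else 0) + (if j = Suc k then (- 1) ^ (i - Suc k) else 0)"
            if "j \<in> {k..i}" for j
          proof -
            have "run (inv_letter l) i j" "run (inv_letter l) j k" using rl that by (auto simp: run_def)
            then show ?thesis using that r True rl by (auto simp: Y_def)
          qed
          then have "(\<Sum>j\<in>{k..i}. Y l i j * Y (inv_letter l) j k) =
            (\<Sum>j\<in>{k..i}. (if j = k then (- 1) ^ (i - k) else 0) + (if j = Suc k then (- 1) ^ (i - Suc k) else 0))"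
            by (intro sum.cong) auto
          also have "\<dots> = (- 1) ^ (i - k) + (- 1) ^ (i - Suc k)"
            using True by (simp add: sum.distrib)
          also have "\<dots> = (0 :: rat)"
            using True by (cases i) (auto simp: Suc_diff_le less_Suc_eq_le)
          finally show ?thesis .
        qed
      next
        case nr: False
        have "Y l i j * Y (inv_letter l) j k = 0" if j: "j \<in> {k..i}" for j
        proof (rule ccontr)
          \<comment> \<open>A nonzero term joins two adjacent runs. Reducedness rules out inverse
            letters at the junction, so the runs merge into one from \<open>k\<close> to
            \<open>i\<close>.\<close>
          assume nz: "Y l i j * Y (inv_letter l) j k \<noteq> 0"
          have 1: "j \<noteq> i" "j \<noteq> k" using nz nr True by (auto simp: Y_def split: if_splits)
          with nz j obtain m m' where m: "run m i j" "run m' j k" "m \<in> {l, inv_letter l}" "m' \<in> {l, inv_letter l}"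
            by (auto simp: Y_def split: if_splits)
          have "j < i" "k < j" using 1 j by auto
          then have "q ! j = m" "q ! (j - 1) = m'" "j < length q" using m by (auto simp: run_def)
          then have "m \<noteq> inv_letter m'" using adj[of "j - 1"] \<open>k < j\<close> by auto
          then have "m = m'" using m by auto
          then have "run m i k" using m(1,2) unfolding run_def by (metis not_le)
          then show False using nr m by auto
        qed
        then show ?thesis by (intro sum.neutral ballI)
      qed
      then show ?thesis using True by (simp add: mat_mul_def mat_one_def)
    next
      case False
      then show ?thesis using uY by (cases "i = k") (auto simp: mat_mul_def mat_one_def unitri_def)
    qed
  qed
  define M where "M i = Y (i, True)" for i
  have inv_unique: "mat_inv A = A'" if "unitri A" "unitri A'" "mat_mul A A' = mat_one" for A A'
  proof (intro ext)
    fix i k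
    show "mat_inv A i k = A' i k"
    proof (induction i rule: less_induct)
      case (less i)
      show ?case
      proof (cases "k < i")
        case True
        have "{k..i} = insert i {k..<i}" using True by auto
        then have "A i i * A' i k + (\<Sum>j\<in>{k..<i}. A i j * A' j k) = 0"
          using fun_cong[OF fun_cong[OF that(3)], of i k] True by (simp add: mat_mul_def mat_one_def)
        then show ?thesis using True less that(1) by (simp add: mat_inv.simps[of A i k] unitri_def)
      next
        case False
        then show ?thesis using that by (auto simp: mat_inv.simps[of A i k] unitri_def)
      qed
    qed
  qed
  have lM: "letter_mat M l = Y l" for l
    using inv_unique[OF uY uY inv, of "(fst l, True)"]
    by (cases l) (auto simp: letter_mat_def M_def)
  \<comment> \<open>Column \<open>0\<close> follows the path: after \<open>j\<close> letters the
    first basis vector has reached index \<open>j\<close> with coefficient \<open>1\<close>, and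
    nothing lies beyond.\<close>
  have "(\<forall>i>j. word_mat Y (rev (take j q)) i 0 = 0) \<and> word_mat Y (rev (take j q)) j 0 = 1"
    if "j \<le> length q" for j
    using that
  proof (induction j)
    case (Suc j)
    let ?W = "word_mat Y (rev (take j q))"
    have IH: "\<And>i. i > j \<Longrightarrow> ?W i 0 = 0" "?W j 0 = 1" using Suc by auto
    have t: "rev (take (Suc j) q) = q ! j # rev (take j q)"
      using Suc.prems by (simp add: take_Suc_conv_app_nth)
    have nr: "\<not> run (inv_letter (q ! j)) i m" if "m \<le> j" "j < i" for i m
      using that inv_letter_simps(5)[of "q ! j"] unfolding run_def by blast
    have z: "Y (q ! j) i m = 0" if "i > Suc j" "m \<le> j" for i m
      using that nr[of m i] by (simp add: Y_def)
    have z': "Y (q ! j) (Suc j) m = (if m = j then 1 else 0)" if "m \<le> j" for m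
    proof -
      have "run (q ! j) (Suc j) j" using Suc.prems le_less_Suc_eq by (auto simp: run_def)
      then show ?thesis using that nr[of m "Suc j"] by (auto simp: Y_def)
    qed
    have "mat_mul (Y (q ! j)) ?W i 0 = 0" if "i > Suc j" for i
      unfolding mat_mul_def
    proof (rule sum.neutral, safe)
      fix m assume "m \<in> {0..i}"
      show "Y (q ! j) i m * ?W m 0 = 0" using IH(1)[of m] z[OF that, of m] by (cases "m \<le> j") auto
    qed
    moreover have "mat_mul (Y (q ! j)) ?W (Suc j) 0 = (\<Sum>m\<in>{0..Suc j}. if m = j then 1 else 0)"
      unfolding mat_mul_def
    proof (rule sum.cong)
      fix m assume "m \<in> {0..Suc j}"
      show "Y (q ! j) (Suc j) m * ?W m 0 = (if m = j then 1 else 0)"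
        using IH(1)[of m] IH(2) z'[of m] by (cases "m \<le> j") auto
    qed simp
    ultimately show ?case by (simp add: t)
  qed (auto simp: mat_one_def)
  from this[of "length q"] have "word_mat Y u (length u) 0 = 1" by (simp add: q_def)
  moreover have "letter_mat M = Y" using lM by (rule ext)
  ultimately have "word_mat (letter_mat M) u \<noteq> mat_one"
    using assms(2) by (auto simp: mat_one_def)
  moreover have "unitri (M i)" for i using uY by (simp add: M_def)
  ultimately show thesis using that by blast
qed

lemma letter_mat_upd: "b \<notin> letters u \<Longrightarrow> word_mat (letter_mat (M(b := B))) u = word_mat (letter_mat M) u"
  by (induction u) (auto simp: letter_mat_def)

text \<open>Matrices that detect the reduced form of \<open>u\<close> can be altered at
  \<open>b\<close> alone to satisfy \<open>r\<close>; as \<open>u\<close> avoids \<open>b\<close>,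
  they still detect it.\<close>

lemma entails_nonzero_exp_sum:
  assumes "entails r u" "exp_sum b r \<noteq> 0" "b \<notin> letters u"
  shows "u \<approx>\<^sub>F []"
proof (rule ccontr)
  assume "\<not> u \<approx>\<^sub>F []"
  then have ne: "norm_word u \<noteq> []" using word_eq_iff_norm by simp
  obtain M where M: "\<And>i. unitri (M i)" "word_mat (letter_mat M) (norm_word u) \<noteq> mat_one"
    by (rule unitri_faithful[OF reduced_norm_word ne]) blast
  obtain B where B: "unitri B" "word_mat (letter_mat (M(b := B))) r = mat_one"
    by (rule solve_unitri[where M = M, OF assms(2) M(1)]) blast
  define M' where "M' = M(b := B)"
  have M': "unitri (M' i)" for i using M(1) B(1) by (simp add: M'_def)
  have "act (\<lambda>i. mat_act (M' i)) r = id"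
    using act_mat[of M', OF M'] B(2) by (simp add: M'_def mat_act_one)
  moreover have "entails r (norm_word u)"
    using entails_word_eq[OF word_eq_sym[OF norm_word_eq] assms(1)] .
  ultimately have "act (\<lambda>i. mat_act (M' i)) (norm_word u) = id"
    using entailsD perms_mat[of M', OF M'] by blast
  then have id: "mat_act (word_mat (letter_mat M') (norm_word u)) = id" using act_mat[of M', OF M'] by simp
  have "b \<notin> letters (norm_word u)" using assms(3) letters_norm_word by blast
  then have W: "word_mat (letter_mat M') (norm_word u) = word_mat (letter_mat M) (norm_word u)"
    unfolding M'_def by (rule letter_mat_upd)
  have "word_mat (letter_mat M) (norm_word u) i k = mat_one i k" for i k
  proof (cases "k \<le> i")
    case True
    then show ?thesis using mat_act_entry[OF True, of "word_mat (letter_mat M) (norm_word u)"] id W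
      by (simp add: mat_one_def)
  next
    case False
    have "unitri (word_mat (letter_mat M) (norm_word u))"
      by (intro unitri_word_mat unitri_letter_mat M(1))
    then show ?thesis using False by (simp add: unitri_def mat_one_def)
  qed
  then show False using M(2) by blast
qed

section \<open>Rewriting with respect to a letter of exponent sum zero\<close>

text \<open>The letter \<open>enc y h\<close> stands for \<open>t\<^sup>h y t\<^sup>-\<^sup>h\<close>.\<close>

definition enc :: "nat \<Rightarrow> int \<Rightarrow> nat" where
  "enc y h = prod_encode (y, int_encode h)"

definition base :: "nat \<Rightarrow> nat" where
  "base n = fst (prod_decode n)"

definition height :: "nat \<Rightarrow> int" where
  "height n = int_decode (snd (prod_decode n))"

lemma enc_simps [simp]:
  "base (enc y h) = y" "height (enc y h) = h" "enc (base n) (height n) = n"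
  "enc y h = enc y' h' \<longleftrightarrow> y = y' \<and> h = h'"
  by (auto simp: enc_def base_def height_def inj_eq[OF inj_int_encode])

text \<open>Magnus rewriting: \<open>h\<close> is the exponent of \<open>t\<close> read so far, and
  each other letter is recorded at the current height.\<close>

fun rewrite :: "nat \<Rightarrow> int \<Rightarrow> letter list \<Rightarrow> letter list" where
  "rewrite t h [] = []"
| "rewrite t h (l # u) = (if fst l = t then rewrite t (if snd l then h + 1 else h - 1) u
     else (enc (fst l) h, snd l) # rewrite t h u)"

definition tpow :: "nat \<Rightarrow> int \<Rightarrow> letter list" where
  "tpow t h = replicate (nat \<bar>h\<bar>) (t, h \<ge> 0)"

definition spread :: "nat \<Rightarrow> nat \<Rightarrow> letter list" where
  "spread t n = tpow t (height n) @ [(base n, True)] @ inv_word (tpow t (height n))"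

lemma word_eq_cancel: "p @ inv_word q @ q @ s \<approx>\<^sub>F p @ s" "p @ q @ inv_word q @ s \<approx>\<^sub>F p @ s"
  by (simp_all add: word_eq_def fun_eq_iff)

lemma tpow_0 [simp]: "tpow t 0 = []"
  by (simp add: tpow_def)

lemma letters_tpow: "letters (tpow t h) \<subseteq> {t}"
  by (auto simp: tpow_def letters_def)

lemma tpow_Suc: "tpow t (h + 1) \<approx>\<^sub>F tpow t h @ [(t, True)]"
proof (cases "h \<ge> 0")
  case True
  then have "nat \<bar>h + 1\<bar> = Suc (nat \<bar>h\<bar>)" by simp
  then show ?thesis using True by (simp add: tpow_def replicate_append_same)
next
  case False
  define n where "n = nat \<bar>h + 1\<bar>"
  have "nat \<bar>h\<bar> = Suc n" using False by (simp add: n_def)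
  then have h: "tpow t h = replicate n (t, False) @ [(t, False)]"
    using False by (simp add: tpow_def replicate_append_same)
  have h1: "tpow t (h + 1) = replicate n (t, False)"
    using False by (cases "h + 1 = 0") (simp_all add: tpow_def n_def)
  show ?thesis
    unfolding h h1 using word_eq_sym[OF word_eq_cancel(2)[of "replicate n (t, False)" "[(t, False)]" "[]"]]
    by simp
qed

lemma tpow_pred: "tpow t (h - 1) \<approx>\<^sub>F tpow t h @ [(t, False)]"
proof -
  have "tpow t h @ [(t, False)] \<approx>\<^sub>F (tpow t (h - 1) @ [(t, True)]) @ [(t, False)]"
    using tpow_Suc[of t "h - 1"] by (intro word_eq_append) auto
  also have "\<dots> \<approx>\<^sub>F tpow t (h - 1)"
    using word_eq_cancel(2)[of "tpow t (h - 1)" "[(t, True)]" "[]"] by simp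
  finally show ?thesis by (rule word_eq_sym)
qed

text \<open>The power of \<open>t\<close> is moved to the right through \<open>u\<close>; each other
  letter that it passes leaves its conjugate behind.\<close>

lemma rewrite_word_eq:
  "tpow t h @ u \<approx>\<^sub>F subst (spread t) (rewrite t h u) @ tpow t (h + exp_sum t u)"
proof (induction u arbitrary: h)
  case (Cons l u)
  show ?case
  proof (cases "fst l = t")
    case True
    define h' where "h' = (if snd l then h + 1 else h - 1)"
    have "tpow t h @ [l] \<approx>\<^sub>F tpow t h'"
      using True word_eq_sym[OF tpow_Suc[of t h]] word_eq_sym[OF tpow_pred[of t h]]
      by (cases l) (auto simp: h'_def)
    from word_eq_append[OF this word_eq_refl, of u]
    have "tpow t h @ l # u \<approx>\<^sub>F tpow t h' @ u" by simp
    from word_eq_trans[OF this Cons[of h']]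
    have "tpow t h @ l # u \<approx>\<^sub>F subst (spread t) (rewrite t h' u) @ tpow t (h' + exp_sum t u)" .
    moreover have "h' + exp_sum t u = h + exp_sum t (l # u)" "rewrite t h (l # u) = rewrite t h' u"
      using True by (simp_all add: h'_def)
    ultimately show ?thesis by simp
  next
    case False
    have "subst_letter (spread t) (enc (fst l) h, snd l) = tpow t h @ [l] @ inv_word (tpow t h)"
      by (cases l) (auto simp: subst_letter_def spread_def)
    moreover have "(tpow t h @ [l] @ inv_word (tpow t h)) @ (subst (spread t) (rewrite t h u) @ tpow t (h + exp_sum t u))
      \<approx>\<^sub>F (tpow t h @ [l] @ inv_word (tpow t h)) @ (tpow t h @ u)"
      by (rule word_eq_append[OF word_eq_refl word_eq_sym[OF Cons]])
    moreover have "(tpow t h @ [l] @ inv_word (tpow t h)) @ (tpow t h @ u) \<approx>\<^sub>F tpow t h @ l # u"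
      using word_eq_cancel(1)[of "tpow t h @ [l]" "tpow t h" u] by simp
    ultimately show ?thesis using False by (auto intro: word_eq_sym word_eq_trans)
  qed
qed simp

lemma rewrite_append: "rewrite t h (u @ v) = rewrite t h u @ rewrite t (h + exp_sum t u) v"
  by (induction u arbitrary: h) (auto simp: algebra_simps)

lemma length_rewrite: "length (rewrite t h u) \<le> length u"
  by (induction u arbitrary: h) (auto intro: le_SucI)

lemma length_rewrite_less: "t \<in> letters u \<Longrightarrow> length (rewrite t h u) < length u"
  by (induction u arbitrary: h) (auto simp: less_Suc_eq_le length_rewrite Suc_le_eq)

lemma base_rewrite: "n \<in> letters (rewrite t h u) \<Longrightarrow> base n \<in> letters u \<and> base n \<noteq> t"
  by (induction u arbitrary: h) (auto split: if_splits)

text \<open>In a reduced word the \<open>t\<close>-letters between two other letters share one sign,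
  so the height moves monotonically.\<close>

lemma rewrite_run:
  assumes "reduced ((t, s) # u)" "rewrite t h u \<noteq> []"
  shows "if s then h \<le> height (fst (hd (rewrite t h u))) else height (fst (hd (rewrite t h u))) \<le> h"
  using assms
proof (induction u arbitrary: h)
  case (Cons l u)
  show ?case
  proof (cases "fst l = t")
    case True
    then have "l = (t, s)" using Cons.prems(1) by (cases l) auto
    then show ?thesis using Cons.IH[of "if s then h + 1 else h - 1"] Cons.prems
      by (auto split: if_splits)
  qed auto
qed simp

text \<open>A leading power of \<open>t\<close> would, by \<open>rewrite_run\<close>, have changed
  the height of the first recorded letter.\<close>

lemma rewrite_hd:
  assumes "reduced u" "rewrite t h u \<noteq> []" "height (fst (hd (rewrite t h u))) = h"
  shows "u \<noteq> []" "fst (hd u) \<noteq> t" "hd (rewrite t h u) = (enc (fst (hd u)) h, snd (hd u))"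
proof -
  show "u \<noteq> []" using assms(2) by auto
  then obtain l v where u: "u = l # v" by (cases u) auto
  show *: "fst (hd u) \<noteq> t"
  proof
    assume "fst (hd u) = t"
    then obtain s where l: "l = (t, s)" using u by (cases l) auto
    show False using rewrite_run[of t s v "if s then h + 1 else h - 1"] assms u l
      by (auto split: if_splits)
  qed
  show "hd (rewrite t h u) = (enc (fst (hd u)) h, snd (hd u))" using * u by simp
qed

text \<open>Cancelling neighbours have equal heights, so by \<open>rewrite_hd\<close> no
  \<open>t\<close> separated them in \<open>u\<close>, where they would cancel already.\<close>

lemma reduced_rewrite: "reduced u \<Longrightarrow> reduced (rewrite t h u)"
proof (induction u arbitrary: h)
  case (Cons l u)
  have u: "reduced u" using Cons.prems by (rule reduced_Cons)
  show ?case
  proof (cases "fst l = t \<or> rewrite t h u = []")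
    case True
    then show ?thesis using Cons.IH[OF u] by auto
  next
    case False
    have "hd (rewrite t h u) \<noteq> inv_letter (enc (fst l) h, snd l)"
    proof
      assume a: "hd (rewrite t h u) = inv_letter (enc (fst l) h, snd l)"
      then have "height (fst (hd (rewrite t h u))) = h" by simp
      from rewrite_hd[OF u _ this] False a have "u \<noteq> []" "hd u = inv_letter l"
        by (auto simp: inv_letter_def prod_eq_iff)
      then show False using Cons.prems by (cases u) auto
    qed
    then show ?thesis using False Cons.IH[OF u, of h]
      by (cases "rewrite t h u") auto
  qed
qed simp

section \<open>Rewriting a cyclically reduced relator of exponent sum zero\<close>

lemma reduced_single_letter:
  assumes "reduced u" "letters u \<subseteq> {t}"
  obtains n s where "u = replicate n (t, s)"
proof -
  have "\<exists>s. u = replicate (length u) (t, s)"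
    using assms
  proof (induction u rule: reduced.induct)
    case (3 x y zs)
    then obtain s where "y # zs = replicate (length (y # zs)) (t, s)" by auto
    then show ?case using 3 by (cases x; cases y) (auto simp: inv_letter_def)
  qed (auto simp: prod_eq_iff)
  then show thesis using that by blast
qed

lemma exp_sum_replicate: "exp_sum t (replicate n (t, s)) = (if s then int n else - int n)"
  by (induction n) auto

lemma cyclically_reduced_double: "cyclically_reduced v \<longleftrightarrow> reduced (v @ v)"
  by (cases "v = []") (auto simp: cyclically_reduced_iff reduced_append_iff)

lemma rewrite_eq_Nil: "rewrite t h u = [] \<longleftrightarrow> letters u \<subseteq> {t}"
  by (induction u arbitrary: h) auto

text \<open>A rotation of \<open>r\<close> starts with a letter other than \<open>t\<close>,
  recorded at height \<open>0\<close>. Exponent sum zero makes rewriting commute with doubling, and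
  a word is cyclically reduced iff its double is reduced.\<close>

lemma rewriting:
  assumes "cyclically_reduced r" "t \<in> letters r" "exp_sum t r = 0"
  obtains v p where "r \<approx>\<^sub>F p @ subst (spread t) v @ inv_word p" "cyclically_reduced v"
    "length v < length r" "\<exists>n\<in>letters v. \<exists>n'\<in>letters v. height n \<noteq> height n'"
    "\<And>n. n \<in> letters v \<Longrightarrow> base n \<noteq> t \<and> base n \<in> letters r"
proof -
  have "\<exists>l\<in>set r. fst l \<noteq> t"
  proof (rule ccontr)
    assume "\<not> (\<exists>l\<in>set r. fst l \<noteq> t)"
    then have "letters r \<subseteq> {t}" by (auto simp: letters_def)
    then obtain n s where "r = replicate n (t, s)"
      using assms(1) reduced_single_letter cyclically_reduced_iff by metis
    then show False using assms(2,3) by (auto simp: exp_sum_replicate split: if_splits)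
  qed
  then obtain l p q where l: "fst l \<noteq> t" and r: "r = p @ l # q" by (metis split_list)
  define u where "u = l # q @ p"
  have cu: "cyclically_reduced u"
    using cyclically_reduced_rotate[of p "l # q"] assms(1) r by (simp add: u_def)
  then have ruu: "reduced (u @ u)" by (simp add: cyclically_reduced_double)
  have eu: "exp_sum t u = 0" and lu: "length u = length r" and tu: "letters u = letters r"
    using assms(3) r by (auto simp: u_def)
  define v where "v = rewrite t 0 u"
  have vv: "rewrite t 0 (u @ u) = v @ v" by (simp add: rewrite_append eu v_def)
  have "r \<approx>\<^sub>F p @ u @ inv_word p"
    using word_eq_sym[OF word_eq_cancel(2)[of r p "[]"]] by (simp add: r u_def)
  moreover have "u \<approx>\<^sub>F subst (spread t) v"
    using rewrite_word_eq[of t 0 u] by (simp add: eu v_def)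
  ultimately have "r \<approx>\<^sub>F p @ subst (spread t) v @ inv_word p"
    by (meson word_eq_append word_eq_refl word_eq_trans)
  moreover have "cyclically_reduced v"
    using reduced_rewrite[OF ruu, of t 0] by (simp add: vv cyclically_reduced_double)
  moreover have "length v < length r"
    unfolding v_def using length_rewrite_less[of t u 0] tu lu assms(2) by simp
  moreover have "\<exists>n\<in>letters v. \<exists>n'\<in>letters v. height n \<noteq> height n'"
  proof -
    have 0: "enc (fst l) 0 \<in> letters v" using l by (simp add: v_def u_def)
    obtain a s b where ab: "u = a @ (t, s) # b" and a: "t \<notin> letters a"
    proof -
      have "\<exists>x\<in>set u. fst x = t" using assms(2)[folded tu] by (auto simp: letters_def)
      then obtain a x b where "u = a @ x # b" "fst x = t" "\<forall>y\<in>set a. fst y \<noteq> t"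
        using split_list_first_prop[of u "\<lambda>x. fst x = t"] by blast
      then show thesis using that[of a "snd x" b] by (cases x) (auto simp: letters_def)
    qed
    have ea: "exp_sum t a = 0" using a by (induction a) auto
    define h where "h = (if s then 1 else - 1 :: int)"
    \<comment> \<open>Appending another copy of \<open>u\<close> guarantees a letter other than
      \<open>t\<close> after the first \<open>t\<close>; it lies strictly above or below height
      \<open>0\<close>.\<close>
    define x where "x = rewrite t h (b @ u)"
    have "v @ v = rewrite t 0 a @ x"
      unfolding vv[symmetric] using ea by (subst ab) (simp add: rewrite_append h_def x_def)
    moreover have x: "x \<noteq> []" unfolding x_def rewrite_eq_Nil using l by (simp add: u_def)
    ultimately have "fst (hd x) \<in> letters v"
      by (metis (no_types, lifting) Un_iff Un_absorb hd_in_set image_eqI letters_def letters_simps(3))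
    moreover have "reduced ((t, s) # b @ u)"
      using ruu ab by (metis append.assoc append_Cons reduced_appendD)
    then have "height (fst (hd x)) \<noteq> 0"
      using rewrite_run[of t s "b @ u" h] x unfolding x_def by (auto simp: h_def split: if_splits)
    ultimately show ?thesis using 0 by (metis enc_simps(2))
  qed
  moreover have "base n \<noteq> t \<and> base n \<in> letters r" if "n \<in> letters v" for n
    using base_rewrite that tu unfolding v_def by metis
  ultimately show thesis by (rule that)
qed

section \<open>The Freiheitssatz\<close>

text \<open>One point is chosen in each orbit of the subgroup generated by the letters in
  \<open>A\<close>. The invariant \<open>c\<close> takes every value on the chosen points, so there
  are infinitely many.\<close>

lemma orbit_transversal:
  fixes f :: "nat \<Rightarrow> nat \<Rightarrow> nat"
  assumes f: "perms f" and c: "\<And>u x. c (act f u x) = c x" and sc: "surj (c :: nat \<Rightarrow> nat)"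
  obtains T where "infinite T" "\<And>x. \<exists>z\<in>T. \<exists>u. letters u \<subseteq> A \<and> x = act f u z"
    "\<And>z z' u. z \<in> T \<Longrightarrow> z' \<in> T \<Longrightarrow> letters u \<subseteq> A \<Longrightarrow> act f u z = z' \<Longrightarrow> z = z'"
proof -
  define orb where "orb x = {act f u x | u. letters u \<subseteq> A}" for x
  have eq: "orb (act f u x) = orb x" if u: "letters u \<subseteq> A" for u x
  proof
    show "orb (act f u x) \<subseteq> orb x"
    proof
      fix y assume "y \<in> orb (act f u x)"
      then obtain v where "letters v \<subseteq> A" "y = act f (v @ u) x" by (auto simp: orb_def)
      then show "y \<in> orb x" using u unfolding orb_def by (metis (mono_tags, lifting) Un_least letters_simps(3) mem_Collect_eq)
    qed
    show "orb x \<subseteq> orb (act f u x)"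
    proof
      fix y assume "y \<in> orb x"
      then obtain v where v: "letters v \<subseteq> A" "y = act f v x" by (auto simp: orb_def)
      have "y = act f (v @ inv_word u) (act f u x)" using f v by simp
      moreover have "letters (v @ inv_word u) \<subseteq> A" using u v by simp
      ultimately show "y \<in> orb (act f u x)" unfolding orb_def by blast
    qed
  qed
  define \<rho> where "\<rho> x = (SOME y. y \<in> orb x)" for x
  have "x \<in> orb x" for x unfolding orb_def by (auto intro!: exI[of _ "[]"])
  then have \<rho>: "\<rho> x \<in> orb x" for x unfolding \<rho>_def by (rule someI)
  have \<rho>_eq: "\<rho> (act f u x) = \<rho> x" if "letters u \<subseteq> A" for u x
    using eq[OF that] by (simp add: \<rho>_def)
  show thesis
  proof
    have "c (\<rho> x) = c x" for x using \<rho>[of x] c by (auto simp: orb_def)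
    then have "c ` range \<rho> = UNIV" using sc by (metis image_image image_cong)
    then show "infinite (range \<rho>)" by (metis finite_imageI infinite_UNIV_nat)
    show "\<exists>z\<in>range \<rho>. \<exists>u. letters u \<subseteq> A \<and> x = act f u z" for x
    proof -
      obtain u where u: "letters u \<subseteq> A" "\<rho> x = act f u x" using \<rho>[of x] by (auto simp: orb_def)
      then have "x = act f (inv_word u) (\<rho> x)" using f by simp
      moreover have "letters (inv_word u) \<subseteq> A" using u by simp
      ultimately show ?thesis by blast
    qed
    show "z = z'" if "z \<in> range \<rho>" "z' \<in> range \<rho>" "letters u \<subseteq> A" "act f u z = z'" for z z' u
    proof -
      have idem: "\<rho> (\<rho> x) = \<rho> x" for x using \<rho>[of x] \<rho>_eq by (auto simp: orb_def)
      then have "\<rho> z = z" "\<rho> z' = z'" using that(1,2) by auto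
      then show ?thesis using \<rho>_eq[OF that(3), of z] that(4) by simp
    qed
  qed
qed

section \<open>Translation of heights, which stands for conjugation by powers of
  \<open>t\<close>\<close>

definition shift :: "int \<Rightarrow> letter list \<Rightarrow> letter list" where
  "shift k = subst (\<lambda>n. [(enc (base n) (height n + k), True)])"

lemma subst_letter_single: "subst_letter (\<lambda>n. [(\<sigma> n, True)]) l = [(\<sigma> (fst l), snd l)]"
  by (cases l) (simp add: subst_letter_def)

lemma shift_simps [simp]:
  "shift k [] = []" "shift k (l # u) = (enc (base (fst l)) (height (fst l) + k), snd l) # shift k u"
  "shift k (u @ v) = shift k u @ shift k v" "shift k (inv_word u) = inv_word (shift k u)"
  by (simp_all add: shift_def subst_letter_single subst_inv_word)

lemma shift_shift [simp]: "shift k (shift k' u) = shift (k' + k) u"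
  by (induction u) (auto simp: algebra_simps)

lemma shift_0 [simp]: "shift 0 u = u"
  by (induction u) auto

lemma shift_word_eq: "u \<approx>\<^sub>F v \<Longrightarrow> shift k u \<approx>\<^sub>F shift k v"
  unfolding shift_def by (rule word_eq_subst)

lemma act_word_eq_Nil: "perms f \<Longrightarrow> u \<approx>\<^sub>F [] \<Longrightarrow> act f u = id"
  using word_eqD by fastforce

lemma tpow_Suc': "tpow t (h + 1) \<approx>\<^sub>F (t, True) # tpow t h"
proof -
  have "exp_sum t (tpow t h) = h" by (simp add: tpow_def exp_sum_replicate)
  moreover have "rewrite t 1 (tpow t h) = []" using letters_tpow by (simp add: rewrite_eq_Nil)
  ultimately have "tpow t 1 @ tpow t h \<approx>\<^sub>F tpow t (1 + h)"
    using rewrite_word_eq[of t 1 "tpow t h"] by simp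
  then show ?thesis using word_eq_sym by (simp add: tpow_def[of t 1] add.commute)
qed

text \<open>The Higman--Neumann--Neumann embedding. Letters of height below \<open>M\<close> and letters of height above
  \<open>m\<close> both generate free groups acting freely with infinitely many orbits, so some permutation \<open>\<tau>\<close>
  conjugates one action to the other.\<close>

lemma hnn_embedding:
  assumes "m < M"
    and heights: "\<And>n. n \<in> letters r \<union> letters u \<Longrightarrow> m \<le> height n \<and> height n \<le> M \<and> base n \<noteq> t"
    and free1: "\<And>v. entails r v \<Longrightarrow> height ` letters v \<subseteq> {m..<M} \<Longrightarrow> v \<approx>\<^sub>F []"
    and free2: "\<And>v. entails r v \<Longrightarrow> height ` letters v \<subseteq> {m<..M} \<Longrightarrow> v \<approx>\<^sub>F []"
    and ent: "entails (subst (spread t) r) (subst (spread t) u)"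
  shows "entails r u"
proof -
  obtain f :: "nat \<Rightarrow> nat \<Rightarrow> nat" and c :: "nat \<Rightarrow> nat"
    where fc: "perms f \<and> (\<forall>u. act f u = id \<longleftrightarrow> entails r u) \<and>
    (\<forall>u x. act f u x = x \<longrightarrow> act f u = id) \<and> (\<forall>u x. c (act f u x) = c x) \<and> surj c"
    using universal_action[of r] by (elim exE)
  have f: "perms f" and fr: "act f u = id \<longleftrightarrow> entails r u"
    and free: "act f u x = x \<Longrightarrow> act f u = id"
    and c: "c (act f u x) = c x" "surj c" for u x
    using fc by blast+
  define A1 where "A1 = height -` {m..<M}"
  define A2 where "A2 = height -` {m<..M}"
  have free1': "v \<approx>\<^sub>F []" if "entails r v" "letters v \<subseteq> A1" for v
    using free1[OF that(1)] that(2) by (auto simp: A1_def)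
  have free2': "v \<approx>\<^sub>F []" if "entails r v" "letters v \<subseteq> A2" for v
    using free2[OF that(1)] that(2) by (auto simp: A2_def)
  have A12: "letters (shift 1 v) \<subseteq> A2 \<longleftrightarrow> letters v \<subseteq> A1" for v
    by (induction v) (auto simp: A1_def A2_def)
  have A21: "letters (shift (- 1) v) \<subseteq> A1 \<longleftrightarrow> letters v \<subseteq> A2" for v
    by (induction v) (auto simp: A1_def A2_def)
  obtain T1 where T1: "infinite T1" "\<And>x. \<exists>z\<in>T1. \<exists>u. letters u \<subseteq> A1 \<and> x = act f u z"
    "\<And>z z' u. z \<in> T1 \<Longrightarrow> z' \<in> T1 \<Longrightarrow> letters u \<subseteq> A1 \<Longrightarrow> act f u z = z' \<Longrightarrow> z = z'"
    by (rule orbit_transversal[where A = A1, OF f c]) blast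
  obtain T2 where T2: "infinite T2" "\<And>x. \<exists>z\<in>T2. \<exists>u. letters u \<subseteq> A2 \<and> x = act f u z"
    "\<And>z z' u. z \<in> T2 \<Longrightarrow> z' \<in> T2 \<Longrightarrow> letters u \<subseteq> A2 \<Longrightarrow> act f u z = z' \<Longrightarrow> z = z'"
    by (rule orbit_transversal[where A = A2, OF f c]) blast
  define \<theta> where "\<theta> = inv_into T2 (to_nat_on T2) \<circ> to_nat_on T1"
  have \<theta>: "bij_betw \<theta> T1 T2"
    unfolding \<theta>_def using T1(1) T2(1)
    by (intro bij_betw_trans[OF to_nat_on_infinite] bij_betw_inv_into to_nat_on_infinite) auto
  have uniq1: "z = z'" "act f v = act f v'"
    if "letters v \<subseteq> A1" "letters v' \<subseteq> A1" "z \<in> T1" "z' \<in> T1" "act f v z = act f v' z'" for v v' z z'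
  proof -
    have e: "act f (inv_word v' @ v) z = z'" using that(5) f by simp
    then show "z = z'" using T1(3)[OF that(3,4) _ e] that(1,2) by simp
    then show "act f v = act f v'" using e free act_inv_eq_id_iff[OF f] by metis
  qed
  have uniq2: "z = z'" "act f v = act f v'"
    if "letters v \<subseteq> A2" "letters v' \<subseteq> A2" "z \<in> T2" "z' \<in> T2" "act f v z = act f v' z'" for v v' z z'
  proof -
    have e: "act f (inv_word v' @ v) z = z'" using that(5) f by simp
    then show "z = z'" using T2(3)[OF that(3,4) _ e] that(1,2) by simp
    then show "act f v = act f v'" using e free act_inv_eq_id_iff[OF f] by metis
  qed
  \<comment> \<open>Relations among letters in \<open>A1\<close> hold already in the free group, so
    they survive the shift; \<open>sh2\<close> is the converse.\<close>
  have sh1: "act f (shift 1 v) = act f (shift 1 v')"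
    if "letters v \<subseteq> A1" "letters v' \<subseteq> A1" "act f v = act f v'" for v v'
  proof -
    have "entails r (inv_word v' @ v)" using that(3) act_inv_eq_id_iff[OF f] fr by metis
    then have "inv_word v' @ v \<approx>\<^sub>F []" using that(1,2) by (intro free1') auto
    from act_word_eq_Nil[OF f shift_word_eq[OF this, of 1, simplified]]
    show ?thesis using act_inv_eq_id_iff[OF f] by metis
  qed
  have sh2: "act f v = act f v'"
    if "letters v \<subseteq> A1" "letters v' \<subseteq> A1" "act f (shift 1 v) = act f (shift 1 v')" for v v'
  proof -
    have "entails r (inv_word (shift 1 v') @ shift 1 v)"
      using that(3) act_inv_eq_id_iff[OF f] fr by metis
    then have "entails r (shift 1 (inv_word v' @ v))" by simp
    then have "shift 1 (inv_word v' @ v) \<approx>\<^sub>F []" using that(1,2) A12 by (intro free2') auto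
    from shift_word_eq[OF this, of "- 1"] have "inv_word v' @ v \<approx>\<^sub>F []" by simp
    from act_word_eq_Nil[OF f this] show ?thesis using act_inv_eq_id_iff[OF f] by metis
  qed
  \<comment> \<open>\<open>\<tau>\<close> carries orbits of \<open>A1\<close> to orbits of
    \<open>A2\<close>, turning \<open>v\<close> into \<open>shift 1 v\<close>; \<open>sh1\<close>
    makes it well defined and \<open>sh2\<close> makes it injective.\<close>
  define \<tau> where "\<tau> x = (SOME y. \<exists>z v. z \<in> T1 \<and> letters v \<subseteq> A1 \<and> x = act f v z \<and> y = act f (shift 1 v) (\<theta> z))" for x
  have \<tau>: "\<tau> (act f v z) = act f (shift 1 v) (\<theta> z)" if "z \<in> T1" "letters v \<subseteq> A1" for v z
    unfolding \<tau>_def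
  proof (rule some_equality)
    fix y assume "\<exists>z' v'. z' \<in> T1 \<and> letters v' \<subseteq> A1 \<and> act f v z = act f v' z' \<and> y = act f (shift 1 v') (\<theta> z')"
    then obtain z' v' where *: "z' \<in> T1" "letters v' \<subseteq> A1" "act f v z = act f v' z'" "y = act f (shift 1 v') (\<theta> z')"
      by blast
    then have "z = z'" "act f v = act f v'" using uniq1[OF that(2) *(2) that(1) *(1,3)] by auto
    then show "y = act f (shift 1 v) (\<theta> z)" using *(4) sh1[OF that(2) *(2)] by simp
  qed (use that in blast)
  have \<theta>T: "\<theta> z \<in> T2" if "z \<in> T1" for z using \<theta> that by (auto simp: bij_betw_def)
  have "bij \<tau>"
  proof (rule bijI)
    show "inj \<tau>"
    proof (rule injI)
      fix x y assume xy: "\<tau> x = \<tau> y"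
      obtain z v where z: "z \<in> T1" "letters v \<subseteq> A1" "x = act f v z" using T1(2) by blast
      obtain z' v' where z': "z' \<in> T1" "letters v' \<subseteq> A1" "y = act f v' z'" using T1(2) by blast
      have *: "act f (shift 1 v) (\<theta> z) = act f (shift 1 v') (\<theta> z')"
        using xy \<tau>[OF z(1,2)] \<tau>[OF z'(1,2)] z(3) z'(3) by simp
      have l: "letters (shift 1 v) \<subseteq> A2" "letters (shift 1 v') \<subseteq> A2" using A12 z(2) z'(2) by blast+
      have "\<theta> z = \<theta> z'" "act f (shift 1 v) = act f (shift 1 v')"
        using uniq2[OF l \<theta>T[OF z(1)] \<theta>T[OF z'(1)] *] by blast+
      then have "z = z'" "act f v = act f v'"
        using inj_onD[OF bij_betw_imp_inj_on[OF \<theta>] _ z(1) z'(1)] sh2[OF z(2) z'(2)] by blast+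
      then show "x = y" using z z' by simp
    qed
    show "surj \<tau>"
    proof (rule surjI)
      fix y
      obtain z v where z: "z \<in> T2" "letters v \<subseteq> A2" "y = act f v z" using T2(2) by blast
      then obtain z' where z': "z' \<in> T1" "z = \<theta> z'" using \<theta> by (auto simp: bij_betw_def)
      have "\<tau> (act f (shift (- 1) v) z') = y" using \<tau>[OF z'(1), of "shift (- 1) v"] A21 z z' by simp
      then show "\<tau> (inv_into UNIV \<tau> y) = y" by (metis f_inv_into_f rangeI)
    qed
  qed
  have intertwine: "\<tau> (f n x) = f (enc (base n) (height n + 1)) (\<tau> x)" if n: "n \<in> A1" for n x
  proof -
    obtain z v where z: "z \<in> T1" "letters v \<subseteq> A1" "x = act f v z" using T1(2) by blast
    have "\<tau> (act f ((n, True) # v) z) = act f (shift 1 ((n, True) # v)) (\<theta> z)"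
      using z n by (intro \<tau>) auto
    then show ?thesis using \<tau>[OF z(1,2)] z(3) by (simp add: letter_act_def)
  qed
  define zp where "zp h = act (\<lambda>_. \<tau>) (tpow t h)" for h
  \<comment> \<open>\<open>t\<close> acts as \<open>\<tau>\<close>, and \<open>y\<close> acts so
    that its conjugate by \<open>tpow t m\<close> is the given action of \<open>enc y m\<close>;
    conjugating by \<open>\<tau>\<close> then yields the greater heights up to
    \<open>M\<close>.\<close>
  define g where "g y = (if y = t then \<tau> else perm_inv (zp m) \<circ> f (enc y m) \<circ> zp m)" for y
  have p\<tau>: "perms (\<lambda>_. \<tau>)" using \<open>bij \<tau>\<close> by (simp add: perms_def)
  have bz: "bij (zp h)" for h unfolding zp_def by (rule bij_act[OF p\<tau>])
  have g: "perms g"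
    unfolding perms_def g_def using \<open>bij \<tau>\<close> bz permsD[OF f]
    by (auto intro!: bij_comp bij_imp_bij_inv)
  have gz: "act g (tpow t h) = zp h" for h
    unfolding zp_def using letters_tpow[of t h] by (intro act_cong) (auto simp: g_def)
  have spread_act: "act g (spread t (enc y h)) = f (enc y h)" if y: "y \<noteq> t" and "m \<le> h" "h \<le> M" for y h
    using that(2,3)
  proof (induction h rule: int_ge_induct)
    case base
    have "act g (spread t (enc y m)) = zp m \<circ> perm_inv (zp m) \<circ> f (enc y m) \<circ> (zp m \<circ> perm_inv (zp m))"
      using y by (simp add: spread_def act_inv_word[OF g] gz letter_act_def g_def comp_assoc)
    moreover have "zp m \<circ> perm_inv (zp m) = id"
      using bij_is_surj[OF bz[of m]] surj_iff by blast
    ultimately show ?case by simp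
  next
    case (step h)
    have IH: "act g (spread t (enc y h)) = f (enc y h)" using step by simp
    have n: "enc y h \<in> A1" using step by (simp add: A1_def)
    have "act g (tpow t (h + 1)) = \<tau> \<circ> act g (tpow t h)"
      using word_eqD[OF tpow_Suc'[of t h] g] by (simp add: letter_act_def g_def)
    then have "act g (spread t (enc y (h + 1))) = \<tau> \<circ> act g (spread t (enc y h)) \<circ> perm_inv \<tau>"
      using bij_act[OF g] \<open>bij \<tau>\<close>
      by (simp add: spread_def act_inv_word[OF g] o_inv_distrib comp_assoc)
    also have "\<dots> = f (enc y (h + 1)) \<circ> (\<tau> \<circ> perm_inv \<tau>)"
      using intertwine[OF n] by (auto simp: IH fun_eq_iff)
    also have "\<tau> \<circ> perm_inv \<tau> = id" using bij_is_surj[OF \<open>bij \<tau>\<close>] surj_iff by blast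
    finally show ?case by simp
  qed
  have sub: "act g (subst (spread t) v) = act f v" if "letters v \<subseteq> letters r \<union> letters u" for v
    unfolding act_subst[OF g]
  proof (rule act_cong)
    fix n assume "n \<in> letters v"
    then have "m \<le> height n" "height n \<le> M" "base n \<noteq> t" using that heights by auto
    then show "act g (spread t n) = f n" using spread_act[of "base n" "height n"] by simp
  qed
  have "act f r = id" using fr by (simp add: entails_def)
  then have "act g (subst (spread t) r) = id" by (simp add: sub)
  then have "act g (subst (spread t) u) = id" using entailsD[OF ent g] by blast
  then show ?thesis using sub[of u] fr by simp
qed

text \<open>With the extreme heights of \<open>r\<close> as \<open>m\<close> and \<open>M\<close>, a
  word missing one extreme height misses a letter of \<open>r\<close>, so \<open>magnus\<close>
  provides both freeness conditions of \<open>hnn_embedding\<close>.\<close>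

lemma hnn_range:
  assumes "\<exists>n\<in>letters r. \<exists>n'\<in>letters r. height n \<noteq> height n'"
    and base: "\<And>n. n \<in> letters r \<Longrightarrow> base n \<noteq> t"
    and magnus: "\<And>b v. b \<in> letters r \<Longrightarrow> b \<notin> letters v \<Longrightarrow> entails r v \<Longrightarrow> v \<approx>\<^sub>F []"
  obtains m M where "m < M"
    "\<And>n. n \<in> letters r \<Longrightarrow> m \<le> height n \<and> height n \<le> M"
    "\<And>v. entails r v \<Longrightarrow> height ` letters v \<subseteq> {m..<M} \<Longrightarrow> v \<approx>\<^sub>F []"
    "\<And>u. entails (subst (spread t) r) (subst (spread t) u) \<Longrightarrow>
      (\<And>n. n \<in> letters u \<Longrightarrow> m \<le> height n \<and> height n \<le> M \<and> base n \<noteq> t) \<Longrightarrow> entails r u"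
proof -
  define m where "m = Min (height ` letters r)"
  define M where "M = Max (height ` letters r)"
  have fin: "finite (height ` letters r)" "height ` letters r \<noteq> {}" using assms(1) by auto
  have hr: "m \<le> height n \<and> height n \<le> M" if "n \<in> letters r" for n
    using fin that by (simp add: m_def M_def)
  have mM: "m < M"
  proof -
    obtain n n' where "n \<in> letters r" "n' \<in> letters r" "height n \<noteq> height n'"
      using assms(1) by blast
    then show ?thesis using hr[of n] hr[of n'] by linarith
  qed
  obtain nm where nm: "nm \<in> letters r" "height nm = m"
    using Min_in[OF fin] unfolding m_def by auto
  obtain nM where nM: "nM \<in> letters r" "height nM = M"
    using Max_in[OF fin] unfolding M_def by auto
  have free1: "v \<approx>\<^sub>F []" if "entails r v" "height ` letters v \<subseteq> {m..<M}" for v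
  proof -
    have "nM \<notin> letters v" using that(2) nM(2) by force
    then show ?thesis using magnus[OF nM(1) _ that(1)] by blast
  qed
  have free2: "v \<approx>\<^sub>F []" if "entails r v" "height ` letters v \<subseteq> {m<..M}" for v
  proof -
    have "nm \<notin> letters v" using that(2) nm(2) by force
    then show ?thesis using magnus[OF nm(1) _ that(1)] by blast
  qed
  show thesis
  proof (rule that[OF mM hr free1])
    fix u assume ent: "entails (subst (spread t) r) (subst (spread t) u)"
      and u: "\<And>n. n \<in> letters u \<Longrightarrow> m \<le> height n \<and> height n \<le> M \<and> base n \<noteq> t"
    show "entails r u"
      by (rule hnn_embedding[OF mM _ free1 free2 ent]) (use hr base u in auto)
  qed
qed

section \<open>Words placed at a single height\<close>

definition lift :: "int \<Rightarrow> letter list \<Rightarrow> letter list" where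
  "lift h = subst (\<lambda>y. [(enc y h, True)])"

lemma letters_lift: "letters (lift h u) = (\<lambda>y. enc y h) ` letters u"
  by (induction u) (auto simp: lift_def subst_letter_single)

text \<open>The powers of \<open>t\<close> between neighbouring letters cancel.\<close>

lemma subst_spread_lift: "subst (spread t) (lift h u) \<approx>\<^sub>F tpow t h @ u @ inv_word (tpow t h)"
proof (induction u)
  case Nil
  show ?case using word_eq_sym[OF word_eq_cancel(2)[of "[]" _ "[]"]] by (simp add: lift_def)
next
  case (Cons l u)
  have "subst (spread t) (lift h (l # u)) = (tpow t h @ [l] @ inv_word (tpow t h)) @ subst (spread t) (lift h u)"
    by (cases l) (auto simp: lift_def subst_letter_def spread_def)
  also have "\<dots> \<approx>\<^sub>F (tpow t h @ [l] @ inv_word (tpow t h)) @ (tpow t h @ u @ inv_word (tpow t h))"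
    by (rule word_eq_append[OF word_eq_refl Cons])
  also have "\<dots> \<approx>\<^sub>F tpow t h @ (l # u) @ inv_word (tpow t h)"
    using word_eq_cancel(1)[of "tpow t h @ [l]"] by simp
  finally show ?case .
qed

lemma subst_base_lift: "subst (\<lambda>n. [(base n, True)]) (lift h u) = u"
  by (induction u) (auto simp: lift_def subst_letter_single)

text \<open>If the letter \<open>b\<close> has nonzero exponent sum, \<open>r\<close> is an equation for \<open>b\<close> that can be solved
  over the free group on the other letters. Otherwise rewriting with respect to \<open>b\<close> itself
  presents the group as an HNN extension of a one-relator group with a shorter relator.\<close>

theorem freiheitssatz:
  assumes "cyclically_reduced r" "b \<in> letters r" "b \<notin> letters u" "entails r u"
  shows "u \<approx>\<^sub>F []"
  using assms
proof (induction "length r" arbitrary: r b u rule: less_induct)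
  case less
  show ?case
  proof (cases "exp_sum b r = 0")
    case False
    then show ?thesis using less.prems entails_nonzero_exp_sum by blast
  next
    case True
    obtain v p where r: "r \<approx>\<^sub>F p @ subst (spread b) v @ inv_word p" and v: "cyclically_reduced v"
      "length v < length r" "\<exists>n\<in>letters v. \<exists>n'\<in>letters v. height n \<noteq> height n'"
      "\<And>n. n \<in> letters v \<Longrightarrow> base n \<noteq> b \<and> base n \<in> letters r"
      by (rule rewriting[OF less.prems(1,2) True]) blast
    \<comment> \<open>The induction hypothesis for the shorter relator \<open>v\<close> supplies the
      freeness required of the base group.\<close>
    obtain m M where mM: "m < M"
      and free: "\<And>x. entails v x \<Longrightarrow> height ` letters x \<subseteq> {m..<M} \<Longrightarrow> x \<approx>\<^sub>F []"
      and emb: "\<And>x. entails (subst (spread b) v) (subst (spread b) x) \<Longrightarrow>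
        (\<And>n. n \<in> letters x \<Longrightarrow> m \<le> height n \<and> height n \<le> M \<and> base n \<noteq> b) \<Longrightarrow> entails v x"
      by (rule hnn_range[where r = v and t = b, OF v(3) _ less.hyps[OF v(2,1)]]) (use v(4) in blast)+
    have "entails (subst (spread b) v) u"
      using entails_of_conj[OF r less.prems(4)] .
    \<comment> \<open>This conjugate is the image of \<open>lift m u\<close>, whose letters all have
      height \<open>m\<close>, below \<open>M\<close>, so that \<open>free\<close> applies.\<close>
    then have "entails (subst (spread b) v) (tpow b m @ u @ inv_word (tpow b m))"
      by (rule entails_conj)
    then have "entails (subst (spread b) v) (subst (spread b) (lift m u))"
      by (rule entails_word_eq[OF word_eq_sym[OF subst_spread_lift]])
    then have "entails v (lift m u)"
      by (rule emb) (use less.prems(3) mM in \<open>auto simp: letters_lift\<close>)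
    then have "lift m u \<approx>\<^sub>F []" using mM by (intro free) (auto simp: letters_lift)
    from word_eq_subst[OF this, of "\<lambda>n. [(base n, True)]"] show ?thesis by (simp add: subst_base_lift)
  qed
qed

section \<open>Relators with the same consequences as a surface relator\<close>

fun weight :: "(nat \<Rightarrow> int) \<Rightarrow> letter list \<Rightarrow> int" where
  "weight z [] = 0"
| "weight z (l # u) = (if snd l then z (fst l) else - z (fst l)) + weight z u"

lemma weight_append [simp]: "weight z (u @ v) = weight z u + weight z v"
  by (induction u) auto

lemma weight_exp_sum:
  "p \<noteq> q \<Longrightarrow> weight (\<lambda>i. if i = p then \<alpha> else if i = q then \<beta> else 0) u = \<alpha> * exp_sum p u + \<beta> * exp_sum q u"
  by (induction u) (auto simp: algebra_simps)

lemma weight_eq_0: "(\<And>i. i \<in> letters u \<Longrightarrow> z i = 0) \<Longrightarrow> weight z u = 0"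
  by (induction u) auto

text \<open>Let the letter \<open>i\<close> translate the integers by \<open>z i\<close>; a word
  then translates by its weight.\<close>

lemma entails_weight:
  assumes "entails r u" "weight z r = 0"
  shows "weight z u = 0"
proof -
  define f where "f i = (\<lambda>x :: int. x + z i)" for i
  have b: "bij (f i)" for i
    by (rule bij_betw_byWitness[where f' = "\<lambda>x. x - z i"]) (auto simp: f_def)
  then have f: "perms f" by (simp add: perms_def)
  have "perm_inv (f i) x = x - z i" for i x
    using b[of i] by (intro inv_f_eq) (auto simp: f_def bij_is_inj)
  then have "act f v = (\<lambda>x. x + weight z v)" for v
    by (induction v) (auto simp: letter_act_def f_def fun_eq_iff)
  then show ?thesis using entailsD[OF assms(1) f] assms(2) by (auto simp: fun_eq_iff)
qed

lemma entails_inv_word: "entails (inv_word r) u \<longleftrightarrow> entails r u"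
proof -
  have "act f (inv_word r) = id \<longleftrightarrow> act f r = id" if "perms f" for f :: "nat \<Rightarrow> nat \<Rightarrow> nat"
    using act_inv_comp(1,2)[OF that, of r] by (metis comp_id id_comp)
  then show ?thesis unfolding entails_def by blast
qed

text \<open>A cyclic shift within blocks of \<open>n\<close> consecutive integers, or a translation
  if \<open>n = 0\<close>, satisfies the relator but moves points unless
  \<open>n = 1\<close>.\<close>

lemma power_entails_letter:
  assumes "entails (replicate n (b, s)) [(b, True)]"
  shows "n = 1"
proof (rule ccontr)
  assume n: "n \<noteq> 1"
  have ent: "entails (replicate n (b, True)) [(b, True)]"
  proof (cases s)
    case False
    have "inv_word (replicate n (b, True)) = replicate n (b, s)"
      using False by (simp add: inv_word_def)
    then show ?thesis using assms entails_inv_word by metis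
  qed (use assms in simp)
  define g where "g x = (if n = 0 then x + 1 else int n * (x div int n) + (x + 1) mod int n)" for x
  have pw: "(g ^^ j) x = int n * (x div int n) + (x + int j) mod int n" if "n \<noteq> 0" for j x
  proof (induction j)
    case (Suc j)
    have "((x + int j) mod int n + 1) mod int n = (x + int (Suc j)) mod int n"
      by (simp add: mod_simps algebra_simps)
    moreover have "(int n * (x div int n) + (x + int j) mod int n) div int n = x div int n"
      using that by (simp add: div_plus_div_distrib_dvd_left)
    ultimately show ?case using that Suc by (simp add: g_def mod_simps add.assoc)
  qed (simp add: that)
  have gn: "g ^^ n = id"
    by (cases "n = 0") (auto simp: pw fun_eq_iff)
  have "bij g"
  proof (cases "n = 0")
    case True
    then show ?thesis
      by (intro bij_betw_byWitness[where f' = "\<lambda>x. x - 1"]) (auto simp: g_def)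
  next
    case False
    then obtain n' where n': "n = Suc n'" by (cases n) auto
    then have "g \<circ> g ^^ n' = id" "g ^^ n' \<circ> g = id"
      using gn by (simp_all add: funpow_swap1 fun_eq_iff)
    then show ?thesis by (metis o_bij)
  qed
  then have p: "perms (\<lambda>_. g)" by (simp add: perms_def)
  have "act (\<lambda>_. g) (replicate j (b, True)) = g ^^ j" for j
    by (induction j) (auto simp: letter_act_def)
  then have "g = id" using entailsD[OF ent p] gn by (simp add: letter_act_def)
  then have "g 0 = 0" by simp
  then show False using n by (auto simp: g_def split: if_splits)
qed

lemma word_eq_inv_word: "u \<approx>\<^sub>F v \<Longrightarrow> inv_word u \<approx>\<^sub>F inv_word v"
  by (simp add: word_eq_def act_inv_word)

text \<open>\<open>w\<close> rewrites to a conjugate of the word \<open>b\<^sub>h\<^sub>+\<^sub>1 b\<^sub>h\<inverse> v\<^sub>h\<close>, in which \<open>b\<^sub>h\<^sub>+\<^sub>1\<close> occurs once.\<close>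

definition lifted_relator :: "nat \<Rightarrow> letter list \<Rightarrow> int \<Rightarrow> letter list" where
  "lifted_relator b v h = [(enc b (h + 1), True), (enc b h, False)] @ lift h v"

lemma letters_lifted_relator:
  "letters (lifted_relator b v h) = insert (enc b (h + 1)) (insert (enc b h) ((\<lambda>y. enc y h) ` letters v))"
  by (simp add: lifted_relator_def letters_lift)

text \<open>The powers of \<open>t\<close> in the product of the three conjugates telescope, so each
  lifted relator stands for a conjugate of the surface relator.\<close>

lemma subst_lifted_relator:
  "subst (spread t) (lifted_relator b v h) \<approx>\<^sub>F
    tpow t h @ ([(t, True), (b, True), (t, False), (b, False)] @ v) @ inv_word (tpow t h)"
proof -
  let ?p = "tpow t h"
  have "spread t (enc b (h + 1)) \<approx>\<^sub>F (?p @ [(t, True)]) @ [(b, True)] @ inv_word (?p @ [(t, True)])"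
    unfolding spread_def by (simp only: enc_simps) (intro word_eq_append word_eq_refl word_eq_inv_word tpow_Suc)
  then have "spread t (enc b (h + 1)) @ inv_word (spread t (enc b h)) @ subst (spread t) (lift h v) \<approx>\<^sub>F
    ((?p @ [(t, True)]) @ [(b, True)] @ inv_word (?p @ [(t, True)])) @ inv_word (spread t (enc b h)) @
      ?p @ v @ inv_word ?p"
    by (intro word_eq_append word_eq_refl subst_spread_lift)
  also have "\<dots> \<approx>\<^sub>F ?p @ ([(t, True), (b, True), (t, False), (b, False)] @ v) @ inv_word ?p"
    by (simp add: word_eq_def fun_eq_iff spread_def)
  finally show ?thesis by (simp add: lifted_relator_def subst_letter_def)
qed

lemma inv_word_conj:
  assumes "u \<approx>\<^sub>F p @ v @ inv_word p"
  shows "inv_word u \<approx>\<^sub>F p @ inv_word v @ inv_word p"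
  using word_eq_inv_word[OF assms] by simp

text \<open>This is the case of Magnus's conjugacy theorem in which one relator starts with a
  commutator of two letters that do not recur.\<close>

lemma surface_relator_conj:
  assumes w: "w = [(t, True), (b, True), (t, False), (b, False)] @ v"
    and tb: "t \<noteq> b" "t \<notin> letters v" "b \<notin> letters v"
    and cr: "cyclically_reduced r" and cw: "cyclically_reduced w"
    and rw: "entails r w" and wr: "entails w r"
  shows "\<exists>p. r \<approx>\<^sub>F p @ w @ inv_word p \<or> r \<approx>\<^sub>F p @ inv_word w @ inv_word p"
proof -
  \<comment> \<open>Otherwise \<open>r\<close>, a consequence of \<open>w\<close> avoiding
    \<open>t\<close>, is trivial by the Freiheitssatz, and then so is \<open>w\<close>.\<close>
  have t: "t \<in> letters r"
  proof (rule ccontr)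
    assume "t \<notin> letters r"
    then have "r \<approx>\<^sub>F []" using freiheitssatz[OF cw _ _ wr, of t] w by simp
    then have "w \<approx>\<^sub>F []" using rw by (auto simp: entails_def word_eq_def)
    then have "w = []" using reduced_word_eq cw cyclically_reduced_iff by fastforce
    then show False using w by simp
  qed
  have e: "exp_sum t r = 0"
  proof -
    let ?z = "\<lambda>i. if i = t then 1 else if i = b then 0 else 0 :: int"
    have "weight ?z v = 0" using tb by (intro weight_eq_0) auto
    then have "weight ?z w = 0" using tb by (simp add: w)
    then have "weight ?z r = 0" by (rule entails_weight[OF wr])
    then show ?thesis using tb(1) by (simp add: weight_exp_sum)
  qed
  obtain r0 p where r: "r \<approx>\<^sub>F p @ subst (spread t) r0 @ inv_word p" and r0: "cyclically_reduced r0"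
    "\<exists>n\<in>letters r0. \<exists>n'\<in>letters r0. height n \<noteq> height n'"
    "\<And>n. n \<in> letters r0 \<Longrightarrow> base n \<noteq> t \<and> base n \<in> letters r"
    by (rule rewriting[OF cr t e]) blast
  obtain m M where mM: "m < M"
    and emb: "\<And>x. entails (subst (spread t) r0) (subst (spread t) x) \<Longrightarrow>
      (\<And>n. n \<in> letters x \<Longrightarrow> m \<le> height n \<and> height n \<le> M \<and> base n \<noteq> t) \<Longrightarrow> entails r0 x"
    by (rule hnn_range[where r = r0 and t = t, OF r0(2) _ freiheitssatz[OF r0(1)]]) (use r0(3) in blast)+
  have "entails (subst (spread t) r0) w" by (rule entails_of_conj[OF r rw])
  then have "entails (subst (spread t) r0) (subst (spread t) (lifted_relator b v h))" for h
    using entails_conj entails_word_eq word_eq_sym[OF subst_lifted_relator] unfolding w by blast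
  \<comment> \<open>A translate of \<open>w\<close> uses the heights \<open>h\<close> and
    \<open>h + 1\<close>, so both must lie between \<open>m\<close> and \<open>M\<close>.\<close>
  then have lifted: "entails r0 (lifted_relator b v h)" if "m \<le> h" "h < M" for h
    by (rule emb) (use that tb in \<open>auto simp: letters_lifted_relator\<close>)
  have "M = m + 1"
  proof (rule ccontr)
    assume "M \<noteq> m + 1"
    then have M: "m + 1 < M" using mM by simp
    \<comment> \<open>One relator cannot make three letters equal in the abelianisation.\<close>
    have *: "\<alpha> = 0 \<and> \<beta> = 0" if "\<alpha> * exp_sum (enc b m) r0 + \<beta> * exp_sum (enc b (m + 1)) r0 = 0" for \<alpha> \<beta>
    proof -
      let ?z = "\<lambda>i. if i = enc b m then \<alpha> else if i = enc b (m + 1) then \<beta> else 0"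
      have "weight ?z r0 = 0" using that by (subst weight_exp_sum) auto
      then have "weight ?z (lifted_relator b v h) = 0" if "m \<le> h" "h < M" for h
        using entails_weight lifted that by blast
      moreover have "weight ?z (lift h v) = 0" for h
        using tb(3) by (intro weight_eq_0) (auto simp: letters_lift)
      ultimately have "weight ?z [(enc b (h + 1), True), (enc b h, False)] = 0" if "m \<le> h" "h < M" for h
        using that by (simp add: lifted_relator_def)
      from this[of m] this[of "m + 1"] M mM show ?thesis by simp
    qed
    \<comment> \<open>The first choice of coefficients always gives sum zero, so both exponent sums
      vanish; then \<open>\<alpha> = 1\<close>, \<open>\<beta> = 0\<close> also gives zero, against
      the claim.\<close>
    show False using *[of "exp_sum (enc b (m + 1)) r0" "- exp_sum (enc b m) r0"] *[of 1 0] by simp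
  qed
  define x where "x = enc b M"
  \<comment> \<open>A change of basis: \<open>\<sigma>\<close> turns the lifted relator into the
    single letter \<open>x\<close>, and \<open>\<sigma>'\<close> undoes
    \<open>\<sigma>\<close>.\<close>
  define \<sigma> where "\<sigma> n = (if n = x then [(x, True)] @ inv_word (lift m v) @ [(enc b m, True)] else [(n, True)])" for n
  define \<sigma>' where "\<sigma>' n = (if n = x then lifted_relator b v m else [(n, True)])" for n
  have x_notin: "x \<notin> letters (lift m v)" using mM by (auto simp: x_def letters_lift)
  have xm: "x \<noteq> enc b m" using mM by (simp add: x_def)
  have W: "lifted_relator b v m = [(x, True), (enc b m, False)] @ lift m v"
    using \<open>M = m + 1\<close> by (simp add: lifted_relator_def x_def)
  have inv_subst: "subst \<sigma>' (subst \<sigma> u) \<approx>\<^sub>F u" for u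
    unfolding word_eq_def
  proof (intro allI impI)
    fix f :: "nat \<Rightarrow> nat \<Rightarrow> nat" assume f: "perms f"
    define f' where "f' j = act f (\<sigma>' j)" for j
    have f': "perms f'" unfolding f'_def by (rule perms_act[OF f])
    have v: "act f' (lift m v) = act f (lift m v)"
      using x_notin by (intro act_cong) (auto simp: f'_def \<sigma>'_def letter_act_def)
    have "act f' (\<sigma> i) = f i" for i
    proof (cases "i = x")
      case True
      have "act f' (\<sigma> x) = f' x \<circ> act f' (inv_word (lift m v)) \<circ> f' (enc b m)"
        by (simp add: \<sigma>_def letter_act_def comp_assoc)
      also have "\<dots> = act f (([(x, True), (enc b m, False)] @ lift m v) @ inv_word (lift m v) @ [(enc b m, True)])"
        using xm by (simp add: act_inv_word[OF f'] act_inv_word[OF f] v f'_def \<sigma>'_def W letter_act_def comp_assoc)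
      also have "\<dots> = f x"
        using f letter_act_canc[OF f, of "(enc b m, False)"] by (simp add: fun_eq_iff letter_act_def)
      finally show ?thesis using True by simp
    qed (simp add: \<sigma>_def f'_def \<sigma>'_def letter_act_def)
    then have "(\<lambda>i. act f' (\<sigma> i)) = f" by (rule ext)
    moreover have "act f (subst \<sigma>' (subst \<sigma> u)) = act f' (subst \<sigma> u)"
      unfolding act_subst[OF f, of \<sigma>'] f'_def ..
    ultimately show "act f (subst \<sigma>' (subst \<sigma> u)) = act f u"
      using act_subst[OF f', of \<sigma> u] by simp
  qed
  have "subst \<sigma> (lift m v) = lift m v"
  proof -
    have "subst \<sigma> u = u" if "x \<notin> letters u" for u
      using that by (induction u) (auto simp: subst_letter_def \<sigma>_def prod_eq_iff)
    then show ?thesis using x_notin by blast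
  qed
  then have \<sigma>W: "subst \<sigma> (lifted_relator b v m) \<approx>\<^sub>F [(x, True)]"
    using xm by (simp add: W subst_letter_def \<sigma>_def word_eq_def fun_eq_iff letter_act_canc[of _ "(enc b m, True)", simplified])
  have "entails (subst \<sigma> r0) [(x, True)]"
    using entails_word_eq[OF \<sigma>W] entails_subst[OF lifted[OF order_refl mM]] by blast
  moreover obtain q s where q: "subst \<sigma> r0 \<approx>\<^sub>F q @ s @ inv_word q" and s: "cyclically_reduced s"
    by (rule cyclic_reduction[of "subst \<sigma> r0"]) blast
  ultimately have sx: "entails s [(x, True)]" using entails_of_conj by blast
  \<comment> \<open>If \<open>s\<close> contained another letter, the Freiheitssatz would make
    \<open>x\<close> trivial.\<close>
  have "letters s \<subseteq> {x}"
  proof (rule ccontr)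
    assume "\<not> letters s \<subseteq> {x}"
    then obtain y where "y \<in> letters s" "y \<noteq> x" by blast
    then have "[(x, True)] \<approx>\<^sub>F []" using freiheitssatz[OF s _ _ sx] by simp
    then show False using reduced_word_eq by fastforce
  qed
  then obtain n \<epsilon> where n: "s = replicate n (x, \<epsilon>)"
    using reduced_single_letter s cyclically_reduced_iff by metis
  then have "s = [(x, \<epsilon>)]" using power_entails_letter sx by fastforce
  \<comment> \<open>Undoing the change of basis exhibits \<open>r0\<close> as a conjugate of the
    lifted relator or its inverse; \<open>spread t\<close> then leads back to
    \<open>w\<close>.\<close>
  then have "subst \<sigma>' (subst \<sigma> r0) \<approx>\<^sub>F subst \<sigma>' q @ subst_letter \<sigma>' (x, \<epsilon>) @ inv_word (subst \<sigma>' q)"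
    using word_eq_subst[OF q, of \<sigma>'] by (simp add: subst_inv_word)
  then have "r0 \<approx>\<^sub>F subst \<sigma>' q @ subst_letter \<sigma>' (x, \<epsilon>) @ inv_word (subst \<sigma>' q)"
    using inv_subst word_eq_sym word_eq_trans by blast
  from word_eq_subst[OF this, of "spread t"]
  have "subst (spread t) r0 \<approx>\<^sub>F subst (spread t) (subst \<sigma>' q) @
    subst (spread t) (subst_letter \<sigma>' (x, \<epsilon>)) @ inv_word (subst (spread t) (subst \<sigma>' q))"
    by (simp add: subst_inv_word)
  moreover have "subst (spread t) (subst_letter \<sigma>' (x, \<epsilon>)) \<approx>\<^sub>F
    tpow t m @ (if \<epsilon> then w else inv_word w) @ inv_word (tpow t m)"
    using subst_lifted_relator[of t b v m] inv_word_conj[OF subst_lifted_relator[of t b v m]]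
    by (simp add: subst_letter_def \<sigma>'_def w subst_inv_word)
  ultimately have "r \<approx>\<^sub>F p @ (subst (spread t) (subst \<sigma>' q) @ (tpow t m @ (if \<epsilon> then w else inv_word w) @
    inv_word (tpow t m)) @ inv_word (subst (spread t) (subst \<sigma>' q))) @ inv_word p"
    using r by (meson word_eq_append word_eq_refl word_eq_trans)
  then have "r \<approx>\<^sub>F (p @ subst (spread t) (subst \<sigma>' q) @ tpow t m) @ (if \<epsilon> then w else inv_word w) @
    inv_word (p @ subst (spread t) (subst \<sigma>' q) @ tpow t m)" by simp
  then obtain p' where "r \<approx>\<^sub>F p' @ (if \<epsilon> then w else inv_word w) @ inv_word p'" by blast
  then show ?thesis by (cases \<epsilon>) auto
qed

corollary surface_relator_length:
  assumes "w = [(t, True), (b, True), (t, False), (b, False)] @ v"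
    and "t \<noteq> b" "t \<notin> letters v" "b \<notin> letters v"
    and cr: "cyclically_reduced r" and cw: "cyclically_reduced w"
    and "entails r w" "entails w r"
  shows "length r = length w"
  using surface_relator_conj[OF assms] conj_cyclically_reduced_length cr cw
    cyclically_reduced_inv_word inv_word_simps(4) by metis

section \<open>The free group\<close>

lemma carrier_free_group: "u \<in> carrier (free_group k) \<longleftrightarrow> reduced u \<and> letters u \<subseteq> {1..k}"
  by (simp add: free_group_def letters_def)

lemma one_free_group [simp]: "\<one>\<^bsub>free_group k\<^esub> = []"
  by (simp add: free_group_def)

text \<open>\<open>word_mult\<close> cancels letters of \<open>u\<close> against \<open>v\<close>
  without normalising \<open>v\<close>, which agrees with normalisation when \<open>v\<close> is
  reduced.\<close>

lemma mult_free_group: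
  assumes "v \<in> carrier (free_group k)"
  shows "u \<otimes>\<^bsub>free_group k\<^esub> v = norm_word (u @ v)"
proof -
  have "foldr cons_cancel v [] = v"
    using norm_word_reduced assms by (simp add: norm_word_def carrier_free_group)
  then show ?thesis by (simp add: free_group_def word_mult_def norm_word_def)
qed

lemma group_free_group: "group (free_group k)"
proof (rule groupI)
  fix u v x assume u: "u \<in> carrier (free_group k)" and v: "v \<in> carrier (free_group k)"
    and x: "x \<in> carrier (free_group k)"
  have closed: "norm_word (u @ v) \<in> carrier (free_group k)"
    if "u \<in> carrier (free_group k)" "v \<in> carrier (free_group k)" for u v
    using that letters_norm_word[of "u @ v"] by (auto simp: carrier_free_group)
  show "u \<otimes>\<^bsub>free_group k\<^esub> v \<in> carrier (free_group k)"
    using closed[OF u v] v by (simp add: mult_free_group)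
  have "norm_word (u @ v) @ x \<approx>\<^sub>F (u @ v) @ x" "u @ (v @ x) \<approx>\<^sub>F u @ norm_word (v @ x)"
    by (intro word_eq_append norm_word_eq word_eq_refl word_eq_sym[OF norm_word_eq])+
  then have "norm_word (norm_word (u @ v) @ x) = norm_word (u @ norm_word (v @ x))"
    using word_eq_iff_norm by simp
  then show "u \<otimes>\<^bsub>free_group k\<^esub> v \<otimes>\<^bsub>free_group k\<^esub> x = u \<otimes>\<^bsub>free_group k\<^esub> (v \<otimes>\<^bsub>free_group k\<^esub> x)"
    using closed u v x by (simp add: mult_free_group)
next
  fix u assume u: "u \<in> carrier (free_group k)"
  show "\<one>\<^bsub>free_group k\<^esub> \<otimes>\<^bsub>free_group k\<^esub> u = u"
    using u by (simp add: mult_free_group norm_word_reduced carrier_free_group)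
  have "inv_word u @ u \<approx>\<^sub>F []" by (simp add: word_eq_def)
  then have "norm_word (inv_word u @ u) = []" using word_eq_iff_norm by simp
  moreover have "inv_word u \<in> carrier (free_group k)"
    using u by (simp add: carrier_free_group reduced_inv_word)
  ultimately show "\<exists>v\<in>carrier (free_group k). v \<otimes>\<^bsub>free_group k\<^esub> u = \<one>\<^bsub>free_group k\<^esub>"
    using u by (auto simp: mult_free_group)
qed (simp add: carrier_free_group)

lemma mult_word_eq: "v \<in> carrier (free_group k) \<Longrightarrow> u \<otimes>\<^bsub>free_group k\<^esub> v \<approx>\<^sub>F u @ v"
  by (simp add: mult_free_group norm_word_eq)

lemma inv_free_group:
  assumes "u \<in> carrier (free_group k)"
  shows "inv\<^bsub>free_group k\<^esub> u = inv_word u"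
proof -
  interpret group "free_group k" by (rule group_free_group)
  have "inv_word u @ u \<approx>\<^sub>F []" by (simp add: word_eq_def)
  then have "norm_word (inv_word u @ u) = []" using word_eq_iff_norm by simp
  then show ?thesis
    using assms by (intro inv_equality) (auto simp: mult_free_group carrier_free_group reduced_inv_word)
qed

lemma commutator_free_group:
  assumes "u \<in> carrier (free_group k)" "v \<in> carrier (free_group k)"
  shows "commutator (free_group k) u v = norm_word (u @ v @ inv_word u @ inv_word v)"
proof -
  interpret group "free_group k" by (rule group_free_group)
  note i = inv_free_group[OF assms(1)] inv_free_group[OF assms(2)]
    and c = assms inv_closed[OF assms(1)] inv_closed[OF assms(2)]
  have "commutator (free_group k) u v \<approx>\<^sub>F ((u @ v) @ inv_word u) @ inv_word v"
    unfolding commutator_def i[symmetric] using c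
    by (intro word_eq_trans[OF mult_word_eq] word_eq_append word_eq_refl mult_word_eq) auto
  moreover have "commutator (free_group k) u v \<in> carrier (free_group k)"
    unfolding commutator_def using c by auto
  ultimately show ?thesis
    using word_eq_norm norm_word_reduced carrier_free_group by fastforce
qed

text \<open>Conjugates of \<open>r\<close> are entailed, and entailed words are closed under
  products and inverses; this links the normal closure to \<open>entails\<close>.\<close>

lemma normal_closure_entails:
  assumes "u \<in> normal_closure (free_group k) {r}" and r: "r \<in> carrier (free_group k)"
  shows "entails r u"
proof -
  interpret group "free_group k" by (rule group_free_group)
  have S: "u \<in> carrier (free_group k) \<and> entails r u"
    if u: "u \<in> {g \<otimes>\<^bsub>free_group k\<^esub> s \<otimes>\<^bsub>free_group k\<^esub> inv\<^bsub>free_group k\<^esub> g | g s. g \<in> carrier (free_group k) \<and> s \<in> {r}}" for u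
  proof -
    obtain g where g: "g \<in> carrier (free_group k)" and
      ug: "u = g \<otimes>\<^bsub>free_group k\<^esub> r \<otimes>\<^bsub>free_group k\<^esub> inv\<^bsub>free_group k\<^esub> g" using u by blast
    have u_eq: "u \<approx>\<^sub>F (g @ r) @ inv_word g"
      unfolding ug inv_free_group[OF g, symmetric] using g r
      by (intro word_eq_trans[OF mult_word_eq] word_eq_append word_eq_refl mult_word_eq) auto
    have "entails r (g @ r @ inv_word g)" by (rule entails_conj) (simp add: entails_def)
    then have "entails r u" using entails_word_eq[OF word_eq_sym[OF u_eq]] \<open>entails r (g @ r @ inv_word g)\<close> by simp
    then show ?thesis using g r ug by auto
  qed
  have "u \<in> carrier (free_group k) \<and> entails r u"
    using assms(1) unfolding normal_closure_def
  proof (induction rule: generate.induct)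
    case one
    show ?case by (simp add: entails_def carrier_free_group)
  next
    case (incl h)
    then show ?case by (rule S)
  next
    case (inv h)
    from S[OF inv] have "h \<in> carrier (free_group k)" "entails r h" by auto
    moreover from this have "entails r (inv_word h)"
      using act_inv_comp(1) unfolding entails_def by (metis comp_id)
    ultimately show ?case using inv_closed inv_free_group by metis
  next
    case (eng h1 h2)
    then have "entails r (h1 @ h2)" by (simp add: entails_def)
    then show ?case using eng entails_word_eq word_eq_sym[OF mult_word_eq] by blast
  qed
  then show ?thesis ..
qed

section \<open>The surface word as an explicit reduced word\<close>

definition handle_word :: "nat \<Rightarrow> letter list" where
  "handle_word j = [(2 * j - 1, True), (2 * j, True), (2 * j - 1, False), (2 * j, False)]"

text \<open>Downward induction on \<open>j\<close>: handles with different indices share no letters,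
  so nothing cancels when the next one is put in front.\<close>

lemma surface_word_segment:
  assumes "1 \<le> j" "j \<le> n" "2 * (n - 1) \<le> k"
  shows "foldr (\<lambda>j acc. commutator (free_group k) (gen (2*j - 1)) (gen (2*j)) \<otimes>\<^bsub>free_group k\<^esub> acc) [j..<n] []
      = concat (map handle_word [j..<n])
    \<and> reduced (concat (map handle_word [j..<n]))
    \<and> letters (concat (map handle_word [j..<n])) \<subseteq> {2 * j - 1..k}"
  using assms(2,1)
proof (induction rule: inc_induct)
  case (step i)
  define v where "v = concat (map handle_word [Suc i..<n])"
  have v: "foldr (\<lambda>j acc. commutator (free_group k) (gen (2*j - 1)) (gen (2*j)) \<otimes>\<^bsub>free_group k\<^esub> acc) [Suc i..<n] [] = v"
    "reduced v" "letters v \<subseteq> {2 * i + 1..k}"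
    using step by (auto simp: v_def)
  have i: "1 \<le> i" "2 * i \<le> k" using step assms by auto
  have "gen (2 * i - 1) \<in> carrier (free_group k)" "gen (2 * i) \<in> carrier (free_group k)"
    using i by (auto simp: gen_def carrier_free_group)
  then have "commutator (free_group k) (gen (2 * i - 1)) (gen (2 * i)) = norm_word (handle_word i)"
    by (simp add: commutator_free_group gen_def handle_word_def inv_word_def)
  also have rh: "reduced (handle_word i)" using i by (auto simp: handle_word_def)
  then have "norm_word (handle_word i) = handle_word i" by (rule norm_word_reduced)
  finally have c: "commutator (free_group k) (gen (2 * i - 1)) (gen (2 * i)) = handle_word i" .
  have "hd v \<noteq> inv_letter (last (handle_word i))" if "v \<noteq> []"
  proof -
    have "fst (hd v) \<in> letters v" using that by (simp add: letters_def)
    then have "fst (hd v) \<noteq> 2 * i" using v(3) by auto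
    then show ?thesis by (auto simp: handle_word_def)
  qed
  then have rv: "reduced (handle_word i @ v)"
    using rh v(2) by (auto simp: reduced_append_iff)
  have "v \<in> carrier (free_group k)" using v by (auto simp: carrier_free_group)
  then have "handle_word i \<otimes>\<^bsub>free_group k\<^esub> v = handle_word i @ v"
    using rv by (simp add: mult_free_group norm_word_reduced)
  moreover have "[i..<n] = i # [Suc i..<n]" using step by (simp add: upt_rec)
  moreover have "letters (handle_word i @ v) \<subseteq> {2 * i - 1..k}"
  proof -
    have "letters v \<subseteq> {2 * i - 1..k}" using v(3) by (rule order_trans) auto
    then show ?thesis using i by (auto simp: handle_word_def)
  qed
  ultimately show ?case using rv c v(1) by (simp add: v_def)
qed simp

text \<open>Splitting off the first handle gives the shape that
  \<open>surface_relator_length\<close> requires.\<close>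

lemma surface_word_form:
  assumes "even k" "k > 0"
  obtains v where "surface_word k = [(1, True), (2, True), (1, False), (2, False)] @ v"
    "1 \<notin> letters v" "2 \<notin> letters v" "surface_word k \<in> carrier (free_group k)"
    "cyclically_reduced (surface_word k)"
proof -
  define v where "v = concat (map handle_word [2..<k div 2 + 1])"
  have k: "k \<ge> 2" using assms by (auto elim!: evenE)
  have s: "surface_word k = concat (map handle_word [1..<k div 2 + 1])"
    and rs: "reduced (surface_word k)" and ls: "letters (surface_word k) \<subseteq> {1..k}"
    using surface_word_segment[of 1 "k div 2 + 1" k] by (auto simp: surface_word_def)
  have "[1..<k div 2 + 1] = 1 # [2..<k div 2 + 1]" using k by (simp add: upt_rec numeral_2_eq_2 div_greater_zero_iff)
  then have w: "surface_word k = [(1, True), (2, True), (1, False), (2, False)] @ v"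
    using s by (simp add: v_def handle_word_def)
  have lv: "letters v \<subseteq> {3..k}"
    using surface_word_segment[of 2 "k div 2 + 1" k] k unfolding v_def by simp
  have "last (surface_word k) \<noteq> inv_letter (hd (surface_word k))"
  proof (cases "v = []")
    case False
    then have "fst (last v) \<in> letters v" by (simp add: letters_def)
    then have "fst (last v) \<noteq> 1" using lv by auto
    then show ?thesis using False w by auto
  qed (simp add: w)
  then have "cyclically_reduced (surface_word k)" using rs by (simp add: cyclically_reduced_iff)
  moreover have "1 \<notin> letters v" "2 \<notin> letters v" using lv by auto
  moreover have "surface_word k \<in> carrier (free_group k)" using rs ls by (simp add: carrier_free_group)
  ultimately show thesis using that[OF w] by blast
qed

section \<open>Lower central quotients\<close>

lemma commutator_closed:
  "group G \<Longrightarrow> x \<in> carrier G \<Longrightarrow> y \<in> carrier G \<Longrightarrow> commutator G x y \<in> carrier G"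
  by (simp add: commutator_def group.is_monoid group.inv_closed monoid.m_closed)

lemma lcs_subset: "group G \<Longrightarrow> lcs G n \<subseteq> carrier G"
proof (induction n)
  case (Suc n)
  then show ?case
    unfolding lcs.simps by (intro group.generate_incl) (auto intro!: commutator_closed)
qed simp

lemma lcs_subgroup:
  assumes "group G"
  shows "subgroup (lcs G n) G"
proof (cases n)
  case 0
  then show ?thesis using assms by (simp add: group.subgroup_self)
next
  case (Suc m)
  then show ?thesis
    using lcs_subset[OF assms, of m] assms
    by (auto intro!: group.generate_is_subgroup commutator_closed)
qed

lemma commutator_hom:
  assumes "group_hom G H h" "x \<in> carrier G" "y \<in> carrier G"
  shows "h (commutator G x y) = commutator H (h x) (h y)"
proof -
  interpret group_hom G H h by fact
  show ?thesis using assms(2,3) by (simp add: commutator_def)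
qed

lemma lcs_image:
  assumes "group_hom G H h" "h ` carrier G = carrier H"
  shows "h ` lcs G n = lcs H n"
proof (induction n)
  case (Suc n)
  interpret group_hom G H h by fact
  let ?S = "{commutator G x y | x y. x \<in> carrier G \<and> y \<in> lcs G n}"
  have sub: "lcs G n \<subseteq> carrier G" by (rule lcs_subset) (rule G.is_group)
  then have "?S \<subseteq> carrier G" using commutator_closed[OF G.is_group] by auto
  then have "h ` generate G ?S = generate H (h ` ?S)" using generate_img by simp
  also have "h ` ?S = {commutator H x y | x y. x \<in> carrier H \<and> y \<in> lcs H n}"
  proof
    show "h ` ?S \<subseteq> {commutator H x y | x y. x \<in> carrier H \<and> y \<in> lcs H n}"
      using commutator_hom[OF assms(1)] sub Suc assms(2) by fastforce
    show "{commutator H x y | x y. x \<in> carrier H \<and> y \<in> lcs H n} \<subseteq> h ` ?S"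
    proof
      fix z assume "z \<in> {commutator H x y | x y. x \<in> carrier H \<and> y \<in> lcs H n}"
      then obtain x y where "z = commutator H x y" "x \<in> h ` carrier G" "y \<in> h ` lcs G n"
        using Suc assms(2) by auto
      then obtain x' y' where "x' \<in> carrier G" "y' \<in> lcs G n" "z = commutator H (h x') (h y')" by auto
      then have "z = h (commutator G x' y')" "commutator G x' y' \<in> ?S"
        using commutator_hom[OF assms(1)] sub by auto
      then show "z \<in> h ` ?S" by blast
    qed
  qed
  finally show ?case by simp
qed (use assms in simp)

text \<open>Conjugation by \<open>g\<close> is a surjective endomorphism, so it preserves the lower central series.\<close>

lemma lcs_normal:
  assumes "group G"
  shows "lcs G n \<lhd> G"
proof -
  interpret group G by fact
  have "g \<otimes>\<^bsub>G\<^esub> x \<otimes>\<^bsub>G\<^esub> inv\<^bsub>G\<^esub> g \<in> lcs G n" if g: "g \<in> carrier G" and x: "x \<in> lcs G n" for g x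
  proof -
    define h where "h y = g \<otimes>\<^bsub>G\<^esub> y \<otimes>\<^bsub>G\<^esub> inv\<^bsub>G\<^esub> g" for y
    have "h (y \<otimes>\<^bsub>G\<^esub> z) = h y \<otimes>\<^bsub>G\<^esub> h z" if "y \<in> carrier G" "z \<in> carrier G" for y z
      using g that by (simp add: h_def m_assoc inv_solve_left)
    then have hom: "group_hom G G h"
      using g by (intro group_hom.intro group_hom_axioms.intro homI) (auto simp: h_def is_group)
    have "h ` carrier G = carrier G"
    proof
      show "carrier G \<subseteq> h ` carrier G"
      proof
        fix y assume "y \<in> carrier G"
        then have "y = h (inv\<^bsub>G\<^esub> g \<otimes>\<^bsub>G\<^esub> y \<otimes>\<^bsub>G\<^esub> g)" using g
          by (simp add: h_def m_assoc flip: m_assoc[of g "inv\<^bsub>G\<^esub> g" y])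
        then show "y \<in> h ` carrier G" using g \<open>y \<in> carrier G\<close> by blast
      qed
    qed (use g in \<open>auto simp: h_def\<close>)
    from lcs_image[OF hom this, of n] show ?thesis using x by (auto simp: h_def)
  qed
  then show ?thesis using lcs_subgroup[OF assms] by (simp add: normal_inv_iff)
qed

section \<open>Normal closures and quotient maps\<close>

lemma normal_closure_normal:
  assumes "group G" "S \<subseteq> carrier G"
  shows "normal_closure G S \<lhd> G"
proof -
  interpret group G by fact
  let ?T = "{g \<otimes>\<^bsub>G\<^esub> s \<otimes>\<^bsub>G\<^esub> inv\<^bsub>G\<^esub> g | g s. g \<in> carrier G \<and> s \<in> S}"
  have T: "?T \<subseteq> carrier G" using assms(2) by auto
  have "g \<otimes>\<^bsub>G\<^esub> t \<otimes>\<^bsub>G\<^esub> inv\<^bsub>G\<^esub> g \<in> ?T" if "t \<in> ?T" "g \<in> carrier G" for g t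
  proof -
    obtain g' s where t: "t = g' \<otimes>\<^bsub>G\<^esub> s \<otimes>\<^bsub>G\<^esub> inv\<^bsub>G\<^esub> g'" "g' \<in> carrier G" "s \<in> S" using \<open>t \<in> ?T\<close> by blast
    then have "g \<otimes>\<^bsub>G\<^esub> t \<otimes>\<^bsub>G\<^esub> inv\<^bsub>G\<^esub> g = (g \<otimes>\<^bsub>G\<^esub> g') \<otimes>\<^bsub>G\<^esub> s \<otimes>\<^bsub>G\<^esub> inv\<^bsub>G\<^esub> (g \<otimes>\<^bsub>G\<^esub> g')"
      using that(2) assms(2) by (auto simp: m_assoc inv_mult_group subset_iff)
    then show ?thesis using t that(2) by blast
  qed
  then show ?thesis unfolding normal_closure_def using normal_generateI[OF T] by blast
qed

lemma normal_closure_incl: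
  assumes "group G" "S \<subseteq> carrier G"
  shows "S \<subseteq> normal_closure G S"
proof
  interpret group G by fact
  fix s assume s: "s \<in> S"
  then have "s = \<one>\<^bsub>G\<^esub> \<otimes>\<^bsub>G\<^esub> s \<otimes>\<^bsub>G\<^esub> inv\<^bsub>G\<^esub> \<one>\<^bsub>G\<^esub>" using assms(2) by auto
  then show "s \<in> normal_closure G S"
    unfolding normal_closure_def using s by (intro generate.incl) blast
qed

lemma normal_closure_minimal:
  assumes "group G" "K \<lhd> G" "S \<subseteq> K"
  shows "normal_closure G S \<subseteq> K"
proof -
  interpret group G by fact
  show ?thesis
    unfolding normal_closure_def
    using assms(2,3) by (intro generate_subgroup_incl) (auto simp: normal_inv_iff)
qed

lemma vimage_normal:
  assumes "group_hom G H h" "K \<lhd> H"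
  shows "{x \<in> carrier G. h x \<in> K} \<lhd> G"
proof -
  interpret group_hom G H h by fact
  have K: "subgroup K H" "\<And>x y. x \<in> carrier H \<Longrightarrow> y \<in> K \<Longrightarrow> x \<otimes>\<^bsub>H\<^esub> y \<otimes>\<^bsub>H\<^esub> inv\<^bsub>H\<^esub> x \<in> K"
    using assms(2) by (auto simp: H.normal_inv_iff)
  have "subgroup {x \<in> carrier G. h x \<in> K} G"
    by (rule G.subgroupI)
      (auto simp: subgroup.m_closed[OF K(1)] subgroup.m_inv_closed[OF K(1)]
        intro!: exI[of _ "\<one>\<^bsub>G\<^esub>"] subgroup.one_closed[OF K(1)])
  then show ?thesis using K(2) by (auto simp: G.normal_inv_iff)
qed

lemma quotient_hom:
  assumes "N \<lhd> G"
  shows "group_hom G (G Mod N) (\<lambda>x. N #>\<^bsub>G\<^esub> x)" "(\<lambda>x. N #>\<^bsub>G\<^esub> x) ` carrier G = carrier (G Mod N)"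
    "\<And>x. x \<in> carrier G \<Longrightarrow> N #>\<^bsub>G\<^esub> x = \<one>\<^bsub>G Mod N\<^esub> \<longleftrightarrow> x \<in> N"
proof -
  interpret normal N G by fact
  show "group_hom G (G Mod N) (\<lambda>x. N #>\<^bsub>G\<^esub> x)"
    by (intro group_hom.intro group_hom_axioms.intro is_group factorgroup_is_group r_coset_hom_Mod)
  show "(\<lambda>x. N #>\<^bsub>G\<^esub> x) ` carrier G = carrier (G Mod N)"
    by (auto simp: FactGroup_def RCOSETS_def)
  show "N #>\<^bsub>G\<^esub> x = \<one>\<^bsub>G Mod N\<^esub> \<longleftrightarrow> x \<in> N" if "x \<in> carrier G" for x
    using that rcos_self[OF that subgroup_axioms] rcos_const[OF is_group] by (auto simp: FactGroup_def)
qed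

text \<open>Both are \<open>G\<close> modulo the common kernel, by the first isomorphism
  theorem.\<close>

lemma iso_of_equal_kernels:
  assumes "group_hom G H h" "h ` carrier G = carrier H"
    and "group_hom G K g" "g ` carrier G = carrier K"
    and "kernel G H h = kernel G K g"
  shows "H \<cong> K"
proof -
  interpret h: group_hom G H h by fact
  interpret g: group_hom G K g by fact
  have "G Mod kernel G H h \<cong> H" "G Mod kernel G H h \<cong> K"
    using h.FactGroup_iso[OF assms(2)] g.FactGroup_iso[OF assms(4)] assms(5) by auto
  then show ?thesis
    using group.iso_sym[OF normal.factorgroup_is_group[OF h.normal_kernel]] iso_trans by blast
qed

text \<open>In \<open>F/N\<close> the image of \<open>w\<close> is the inverse of a commutator of two conjugates of itself, so it
  lies in every term of the lower central series.\<close>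

lemma relator_in_lcs:
  fixes G (structure)
  assumes "group G" and w: "w \<in> carrier G" and g: "g \<in> carrier G"
    and N: "N \<lhd> G" and r: "w \<otimes> commutator G w (g \<otimes> w \<otimes> inv g) \<in> N"
  shows "\<forall>x\<in>normal_closure G {w}. N #> x \<in> lcs (G Mod N) n"
proof -
  interpret group G by fact
  define h where "h x = N #> x" for x
  note h = quotient_hom(1,2)[OF N, folded h_def]
  interpret h: group_hom G "G Mod N" h by (rule h)
  let ?c = "g \<otimes> w \<otimes> inv g"
  \<comment> \<open>The claim covers the whole normal closure, so that the induction hypothesis
    applies to the conjugate \<open>?c\<close> of \<open>w\<close>.\<close>
  have "\<forall>x\<in>normal_closure G {w}. h x \<in> lcs (G Mod N) n"
  proof (induction n)
    case 0
    have "normal_closure G {w} \<subseteq> carrier G"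
      using normal_closure_normal[OF \<open>group G\<close>, of "{w}"] w by (simp add: normal_imp_subgroup subgroup.subset)
    then show ?case by auto
  next
    case (Suc n)
    have "h (w \<otimes> commutator G w ?c) = \<one>\<^bsub>G Mod N\<^esub>"
      using quotient_hom(3)[OF N] r w g commutator_closed[OF \<open>group G\<close>] by (simp add: h_def)
    then have "h w \<otimes>\<^bsub>G Mod N\<^esub> h (commutator G w ?c) = \<one>\<^bsub>G Mod N\<^esub>"
      using w g commutator_closed[OF \<open>group G\<close>] by simp
    then have hw: "h w = inv\<^bsub>G Mod N\<^esub> h (commutator G w ?c)"
      using w g commutator_closed[OF \<open>group G\<close>] by (intro h.H.inv_equality[symmetric]) auto
    have "w \<in> normal_closure G {w}" using normal_closure_incl[OF \<open>group G\<close>, of "{w}"] w by auto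
    then have "?c \<in> normal_closure G {w}"
      using normal_closure_normal[OF \<open>group G\<close>, of "{w}"] w g by (auto simp: normal_inv_iff)
    then have "h ?c \<in> lcs (G Mod N) n" using Suc by blast
    then have "commutator (G Mod N) (h w) (h ?c) \<in> lcs (G Mod N) (Suc n)"
      unfolding lcs.simps using h.hom_closed[OF w] by (intro generate.incl) blast
    then have "h (commutator G w ?c) \<in> lcs (G Mod N) (Suc n)"
      using commutator_hom[OF h(1)] w g by simp
    then have "h w \<in> lcs (G Mod N) (Suc n)"
      unfolding hw using subgroup.m_inv_closed[OF lcs_subgroup[OF h.H.is_group]] by blast
    \<comment> \<open>The preimage of a term of the series is normal, so with \<open>w\<close> it
      contains the normal closure.\<close>
    then have "normal_closure G {w} \<subseteq> {x \<in> carrier G. h x \<in> lcs (G Mod N) (Suc n)}"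
      using w by (intro normal_closure_minimal \<open>group G\<close> vimage_normal[OF h(1)] lcs_normal h.H.is_group) auto
    then show ?case by blast
  qed
  then show ?thesis by (simp add: h_def)
qed

section \<open>Comparison of the lower central quotients\<close>

lemma coset_eq_decompose:
  fixes G (structure)
  assumes "N \<lhd> G" "x \<in> carrier G" "y \<in> carrier G" "N #> x = N #> y"
  obtains z where "z \<in> N" "x = z \<otimes> y"
proof -
  interpret normal N G by fact
  have "x \<in> N #> y" using rcos_self[OF assms(2) subgroup_axioms] assms(4) by simp
  then show thesis using that by (auto simp: r_coset_def)
qed

text \<open>Both sides are quotients of \<open>G\<close>, so their kernels are compared. An element
  of either kernel is a product of one from \<open>N\<close> or \<open>R\<close> and one from
  \<open>lcs G n\<close>; \<open>N \<subseteq> R\<close> gives one inclusion, and \<open>res\<close>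
  absorbs the factor from \<open>R\<close> for the other.\<close>

lemma lcs_quotient_iso:
  fixes G (structure)
  assumes "group G" and N: "N \<lhd> G" and R: "R \<lhd> G" and "N \<subseteq> R"
    and res: "\<And>x. x \<in> R \<Longrightarrow> N #> x \<in> lcs (G Mod N) n"
  shows "(G Mod N) Mod lcs (G Mod N) n \<cong> (G Mod R) Mod lcs (G Mod R) n"
proof -
  interpret group G by fact
  have *: "group_hom G (G Mod K Mod lcs (G Mod K) n) (\<lambda>x. lcs (G Mod K) n #>\<^bsub>G Mod K\<^esub> (K #> x))"
    "(\<lambda>x. lcs (G Mod K) n #>\<^bsub>G Mod K\<^esub> (K #> x)) ` carrier G = carrier (G Mod K Mod lcs (G Mod K) n)"
    "kernel G (G Mod K Mod lcs (G Mod K) n) (\<lambda>x. lcs (G Mod K) n #>\<^bsub>G Mod K\<^esub> (K #> x))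
      = {x \<in> carrier G. K #> x \<in> lcs (G Mod K) n}" if K: "K \<lhd> G" for K
  proof -
    note q1 = quotient_hom[OF K]
    interpret q1: group_hom G "G Mod K" "\<lambda>x. K #> x" by (rule q1)
    note q2 = quotient_hom[OF lcs_normal[OF q1.H.is_group, of n]]
    interpret q2: group_hom "G Mod K" "G Mod K Mod lcs (G Mod K) n" "\<lambda>x. lcs (G Mod K) n #>\<^bsub>G Mod K\<^esub> x"
      by (rule q2)
    show "group_hom G (G Mod K Mod lcs (G Mod K) n) (\<lambda>x. lcs (G Mod K) n #>\<^bsub>G Mod K\<^esub> (K #> x))"
      using Group.hom_compose[OF q1.homh q2.homh]
      by (intro group_hom.intro group_hom_axioms.intro is_group q2.H.is_group) (simp add: comp_def)
    show "(\<lambda>x. lcs (G Mod K) n #>\<^bsub>G Mod K\<^esub> (K #> x)) ` carrier G = carrier (G Mod K Mod lcs (G Mod K) n)"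
      unfolding q2(2)[symmetric] q1(2)[symmetric] by (rule image_image[symmetric])
    show "kernel G (G Mod K Mod lcs (G Mod K) n) (\<lambda>x. lcs (G Mod K) n #>\<^bsub>G Mod K\<^esub> (K #> x))
      = {x \<in> carrier G. K #> x \<in> lcs (G Mod K) n}"
      unfolding kernel_def using q2(3)[OF q1.hom_closed] by auto
  qed
  have img: "\<exists>y\<in>lcs G n. K #> x = K #> y" if "K \<lhd> G" "K #> x \<in> lcs (G Mod K) n" for K x
    using that(2) lcs_image[OF quotient_hom(1,2)[OF that(1)], of n] by auto
  have in_lcs: "K #> y \<in> lcs (G Mod K) n" if "K \<lhd> G" "y \<in> lcs G n" for K y
    using that(2) lcs_image[OF quotient_hom(1,2)[OF that(1)], of n] by auto
  have sub: "lcs G n \<subseteq> carrier G" by (rule lcs_subset[OF \<open>group G\<close>])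
  have NC: "N \<subseteq> carrier G" "R \<subseteq> carrier G"
    using N R by (simp_all add: normal_imp_subgroup subgroup.subset)
  have "{x \<in> carrier G. N #> x \<in> lcs (G Mod N) n} = {x \<in> carrier G. R #> x \<in> lcs (G Mod R) n}"
  proof (intro Collect_cong conj_cong refl iffI)
    fix x assume x: "x \<in> carrier G" and "N #> x \<in> lcs (G Mod N) n"
    then obtain y where y: "y \<in> lcs G n" "N #> x = N #> y" using img[OF N] by blast
    then obtain z where z: "z \<in> N" "x = z \<otimes> y" using coset_eq_decompose[OF N x] sub by blast
    interpret q: group_hom G "G Mod R" "\<lambda>x. R #> x" by (rule quotient_hom[OF R])
    have "R #> z = \<one>\<^bsub>G Mod R\<^esub>" using quotient_hom(3)[OF R] z assms(4) NC by blast
    then have "R #> x = \<one>\<^bsub>G Mod R\<^esub> \<otimes>\<^bsub>G Mod R\<^esub> (R #> y)"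
      using q.hom_mult[of z y] z y sub NC by (simp only: subset_iff)
    also have "\<dots> = R #> y" using q.hom_closed[of y] y sub by (simp only: subset_iff q.H.l_one)
    finally have "R #> x = R #> y" .
    then show "R #> x \<in> lcs (G Mod R) n" using in_lcs[OF R y(1)] by simp
  next
    fix x assume x: "x \<in> carrier G" and "R #> x \<in> lcs (G Mod R) n"
    then obtain y where y: "y \<in> lcs G n" "R #> x = R #> y" using img[OF R] by blast
    then obtain z where z: "z \<in> R" "x = z \<otimes> y" using coset_eq_decompose[OF R x] sub by blast
    interpret q: group_hom G "G Mod N" "\<lambda>x. N #> x" by (rule quotient_hom[OF N])
    have "N #> x = (N #> z) \<otimes>\<^bsub>G Mod N\<^esub> (N #> y)" using z y sub NC by (simp add: subset_iff q.hom_mult)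
    then show "N #> x \<in> lcs (G Mod N) n"
      using subgroup.m_closed[OF lcs_subgroup[OF q.H.is_group] res[OF z(1)] in_lcs[OF N y(1)]] by simp
  qed
  then show ?thesis
    using iso_of_equal_kernels[OF *(1,2)[OF N] *(1,2)[OF R]] *(3)[OF N] *(3)[OF R] by simp
qed

theorem theorem5:
  fixes k :: nat and \<gamma> :: "letter list"
  defines "F \<equiv> free_group k"
  defines "w \<equiv> surface_word k"
  defines "r \<equiv> w \<otimes>\<^bsub>F\<^esub> commutator F w (\<gamma> \<otimes>\<^bsub>F\<^esub> w \<otimes>\<^bsub>F\<^esub> inv\<^bsub>F\<^esub> \<gamma>)"
  defines "N \<equiv> normal_closure F {r}"
  defines "G \<equiv> F Mod N"
  defines "\<Gamma> \<equiv> F Mod normal_closure F {w}"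
  assumes "even k" and "k > 2"
    and "\<gamma> \<in> carrier F"
    and "cyclically_reduced r"
    and "length r \<noteq> length w"
  shows "(\<forall>i\<ge>1. G Mod lower_central G i \<cong> \<Gamma> Mod lower_central \<Gamma> i)
       \<and> (\<exists>\<phi> \<in> iso F F. \<phi> ` N \<subset> normal_closure F {w})"
proof -
  interpret F: group F unfolding F_def by (rule group_free_group)
  obtain v where v: "w = [(1, True), (2, True), (1, False), (2, False)] @ v"
    "1 \<notin> letters v" "2 \<notin> letters v" and w: "w \<in> carrier F" and cw: "cyclically_reduced w"
    using surface_word_form[of k] \<open>even k\<close> \<open>k > 2\<close> unfolding w_def F_def by auto
  define R where "R = normal_closure F {w}"
  have R: "R \<lhd> F" "w \<in> R"
    using normal_closure_normal[OF F.is_group, of "{w}"] normal_closure_incl[OF F.is_group, of "{w}"] w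
    by (auto simp: R_def)
  then have sR: "subgroup R F" by (simp add: normal_imp_subgroup)
  have c: "\<gamma> \<otimes>\<^bsub>F\<^esub> w \<otimes>\<^bsub>F\<^esub> inv\<^bsub>F\<^esub> \<gamma> \<in> R"
    using R \<open>\<gamma> \<in> carrier F\<close> by (auto simp: F.normal_inv_iff)
  have rR: "r \<in> R"
  proof -
    have "w \<otimes>\<^bsub>F\<^esub> commutator F w x \<in> R" if "x \<in> R" for x
      unfolding commutator_def using R(2) that
      by (intro subgroup.m_closed[OF sR] subgroup.m_inv_closed[OF sR])
    then show ?thesis unfolding r_def using c by blast
  qed
  then have r: "r \<in> carrier F" using subgroup.subset[OF sR] by blast
  have N: "N \<lhd> F" "r \<in> N"
    using normal_closure_normal[OF F.is_group, of "{r}"] normal_closure_incl[OF F.is_group, of "{r}"] r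
    by (auto simp: N_def)
  have NR: "N \<subseteq> R" unfolding N_def using rR R(1) by (intro normal_closure_minimal F.is_group) auto
  \<comment> \<open>Otherwise \<open>r\<close> and \<open>w\<close> entail each other, and
    \<open>surface_relator_length\<close> contradicts the assumption on lengths.\<close>
  have "w \<notin> N"
  proof
    assume "w \<in> N"
    then have "entails r w"
      using normal_closure_entails r by (simp add: N_def F_def)
    moreover have "entails w r"
      using rR w normal_closure_entails by (simp add: R_def F_def)
    ultimately have "length r = length w"
      using surface_relator_length[OF v(1) _ v(2,3) \<open>cyclically_reduced r\<close> cw] by simp
    then show False using \<open>length r \<noteq> length w\<close> by simp
  qed
  then have "id ` N \<subset> R" using NR R(2) by auto
  moreover have "id \<in> iso F F" by (simp add: iso_def hom_def)
  moreover have "G Mod lower_central G i \<cong> \<Gamma> Mod lower_central \<Gamma> i" for i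
    unfolding lower_central_def G_def \<Gamma>_def R_def[symmetric]
    using relator_in_lcs[OF F.is_group w \<open>\<gamma> \<in> carrier F\<close> N(1)] N(2)
    by (intro lcs_quotient_iso[OF F.is_group N(1) R(1) NR]) (simp add: R_def r_def)
  ultimately show ?thesis unfolding R_def by blast
qed

end
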